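(* Let $T>0$, $\mu>0$, $f\in L^2(0,T)$, and let the discrete spaces $S_h^p(0,T)\subset H^2_{0,\bullet}(0,T)$ satisfy Assumption A (stated in the context). Let $u\in H^2_{0,\bullet}(0,T)$ be the unique solution of $$a_\mu(u,w)=(f,\partial_tw)_{L^2(0,T)}\quad\text{for all }w\in H^2_{0,\bullet}(0,T),$$ and let $u_h\in S_h^p(0,T)$ be the unique solution of $$a_\mu(u_h,\mathcal{L}_Tw_h)=(f,\partial_t\mathcal{L}_Tw_h)_{L^2(0,T)}\quad\text{for all }w_h\in S_h^p(0,T).$$ If $u\in H^2_{0,\bullet}(0,T)\cap H^{s+1}(0,T)$ for an integer $s$ with $1\le s\le p$, then $$\|u-u_h\|_{H^2_{0,\bullet}(0,T)}\le C_\mu\,h^{s-2}\,\|\partial_t^{s+1}u\|_{L^2(0,T)},$$ for a positive constant $C_\mu$ depending on $p,T,\mu$ but not on $h$.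
   Context: $H^2_{0,\bullet}(0,T):=\{u\in H^2(0,T): u(0)=0\}$, with norm $\|u\|_{H^2_{0,\bullet}(0,T)}:=\|\partial_t^2u\|_{L^2(0,T)}+\frac1T\|\partial_tu\|_{L^2(0,T)}$; $$a_\mu(u,w):=(\partial_t^2u,\partial_t w)_{L^2(0,T)}+\partial_tu(0)\,\partial_tw(0)+\mu\,(u,\partial_tw)_{L^2(0,T)};\qquad \mathcal{L}_Tw(t):=\int_0^te^{-s/T}\partial_sw(s)\,\mathrm{d}s .$$ $\{S_h^p(0,T)\}_h$ is a family of finite dimensional subspaces of $H^2_{0,\bullet}(0,T)$, depending on a mesh parameter $h>0$, for a fixed polynomial degree $p$. Assumption A: (i) there is a constant $C_I>0$, depending on $p$ but not on $h$, such that for all $w_h\in S_h^p(0,T)$: $\|w_h\|_{H^2_{0,\bullet}(0,T)}\le C_Ih^{-1}\|\partial_tw_h\|_{L^2(0,T)}$ and $\|\partial_tw_h\|_{L^2(0,T)}\le C_Ih^{-1}\|w_h\|_{L^2(0,T)}$. (ii) There is a constant $C_a>0$, depending on $p$ but not on $h$, such that for each integer $0\le s\le p$ and each $w\in H^2_{0,\bullet}(0,T)\cap H^{s+1}(0,T)$ there is a function $\widetilde w_h\in S_h^p(0,T)$ with $\|\partial_t^\ell w-\partial_t^\ell\widetilde w_h\|_{L^2(0,T)}\le C_ah^{s+1-\ell}\|\partial_t^{s+1}w\|_{L^2(0,T)}$ for all $\ell\in\{0,1,2\}$ with $\ell\le s$, and, if in addition $w\in W^{s+1}_\infty(0,T)$,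 also $\|\partial_tw-\partial_t\widetilde w_h\|_{L^\infty(0,T)}\le C_ah^s\|\partial_t^{s+1}w\|_{L^\infty(0,T)}$. Since $C_I,C_a$ count as depending on $p$, the constant $C_\mu$ may depend on them. *)

theory Defs
  imports "HOL-Analysis.Analysis" "HOL-Probability.Essential_Supremum"
begin

text \<open>
  Elements of Lebesgue and Sobolev spaces on \<open>(0,T)\<close> are represented by functions
  \<^typ>\<open>real \<Rightarrow> real\<close>; only their values on \<open>(0,T)\<close> matter, and only up to almost everywhere
  equality. All notions below respect that equality.
\<close>

abbreviation M_int :: "real \<Rightarrow> real measure" where
  "M_int T \<equiv> lebesgue_on {0<..<T}"

definition ae_eq :: "real \<Rightarrow> (real \<Rightarrow> real) \<Rightarrow> (real \<Rightarrow> real) \<Rightarrow> bool" where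
  "ae_eq T u v \<longleftrightarrow> (AE t in M_int T. u t = v t)"

definition L2 :: "real \<Rightarrow> (real \<Rightarrow> real) set" where
  "L2 T = {u \<in> borel_measurable (M_int T). integrable (M_int T) (\<lambda>t. (u t)\<^sup>2)}"

definition L2_inner :: "real \<Rightarrow> (real \<Rightarrow> real) \<Rightarrow> (real \<Rightarrow> real) \<Rightarrow> real" where
  "L2_inner T u v = (LINT t|M_int T. u t * v t)"

definition L2_norm :: "real \<Rightarrow> (real \<Rightarrow> real) \<Rightarrow> real" where
  "L2_norm T u = sqrt (L2_inner T u u)"

definition Linf_norm :: "real \<Rightarrow> (real \<Rightarrow> real) \<Rightarrow> ereal" where
  "Linf_norm T u = esssup (M_int T) (\<lambda>t. ereal \<bar>u t\<bar>)"

definition Linf :: "real \<Rightarrow> (real \<Rightarrow> real) set" where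
  "Linf T = {u \<in> borel_measurable (M_int T). Linf_norm T u < \<infinity>}"

text \<open>
  Weak derivatives, tested with compactly supported \<open>C\<^sup>1\<close> functions (the convention of
  Brezis, \<^emph>\<open>Functional Analysis, Sobolev Spaces and Partial Differential Equations\<close>, Ch. 8; by
  mollification, testing with smooth functions gives the same notion). Local integrability is
  required explicitly because the Bochner integral of a non-integrable function is \<open>0\<close>.
\<close>

definition test_fun :: "real \<Rightarrow> (real \<Rightarrow> real) set" where
  "test_fun T = {\<phi>. \<phi> C1_differentiable_on UNIV \<and>
     (\<exists>a b. 0 < a \<and> b < T \<and> (\<forall>t. t \<notin> {a..b} \<longrightarrow> \<phi> t = 0))}"

definition loc_integrable :: "real \<Rightarrow> (real \<Rightarrow> real) \<Rightarrow> bool" where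
  "loc_integrable T u \<longleftrightarrow> (\<forall>a b. 0 < a \<and> b < T \<longrightarrow> integrable (lebesgue_on {a..b}) u)"

definition is_weak_deriv :: "real \<Rightarrow> (real \<Rightarrow> real) \<Rightarrow> (real \<Rightarrow> real) \<Rightarrow> bool" where
  "is_weak_deriv T u g \<longleftrightarrow> loc_integrable T u \<and> loc_integrable T g \<and>
     (\<forall>\<phi> \<in> test_fun T. (LINT t|M_int T. u t * deriv \<phi> t) = - (LINT t|M_int T. g t * \<phi> t))"

text \<open>A representative of the \<open>k\<close>-th weak derivative; meaningful only if that derivative exists.\<close>

definition weak_deriv :: "real \<Rightarrow> nat \<Rightarrow> (real \<Rightarrow> real) \<Rightarrow> real \<Rightarrow> real" where
  "weak_deriv T k = (\<lambda>u. SOME g. is_weak_deriv T u g) ^^ k"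

text \<open>
  \<open>sobolev T X k\<close> consists of the functions whose weak derivatives of orders \<open>0, \<dots>, k\<close> all exist
  and belong to \<open>X\<close>: it is \<open>H\<^sup>k(0,T)\<close> for \<open>X = L2 T\<close> and the space \<open>W\<close> of order \<open>k\<close> and exponent
  \<open>\<infinity>\<close> for \<open>X = Linf T\<close>.
\<close>

primrec sobolev :: "real \<Rightarrow> (real \<Rightarrow> real) set \<Rightarrow> nat \<Rightarrow> (real \<Rightarrow> real) set" where
  "sobolev T X 0 = X"
| "sobolev T X (Suc k) = {u \<in> X. \<exists>g \<in> sobolev T X k. is_weak_deriv T u g}"

abbreviation Hsp :: "real \<Rightarrow> nat \<Rightarrow> (real \<Rightarrow> real) set" where
  "Hsp T k \<equiv> sobolev T (L2 T) k"

abbreviation Winf :: "real \<Rightarrow> nat \<Rightarrow> (real \<Rightarrow> real) set" where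
  "Winf T k \<equiv> sobolev T (Linf T) k"

text \<open>Value at \<open>0\<close> of the continuous representative (which exists for functions in \<open>H\<^sup>1(0,T)\<close>).\<close>

definition trace0 :: "real \<Rightarrow> (real \<Rightarrow> real) \<Rightarrow> real" where
  "trace0 T u = (THE c. \<exists>v. continuous_on {0..T} v \<and> ae_eq T u v \<and> v 0 = c)"

definition H20 :: "real \<Rightarrow> (real \<Rightarrow> real) set" where
  "H20 T = {u \<in> Hsp T 2. trace0 T u = 0}"

definition H20_norm :: "real \<Rightarrow> (real \<Rightarrow> real) \<Rightarrow> real" where
  "H20_norm T u = L2_norm T (weak_deriv T 2 u) + 1 / T * L2_norm T (weak_deriv T 1 u)"

definition a_form :: "real \<Rightarrow> real \<Rightarrow> (real \<Rightarrow> real) \<Rightarrow> (real \<Rightarrow> real) \<Rightarrow> real" where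
  "a_form T \<mu> u w =
     L2_inner T (weak_deriv T 2 u) (weak_deriv T 1 w)
     + trace0 T (weak_deriv T 1 u) * trace0 T (weak_deriv T 1 w)
     + \<mu> * L2_inner T u (weak_deriv T 1 w)"

definition L_op :: "real \<Rightarrow> (real \<Rightarrow> real) \<Rightarrow> real \<Rightarrow> real" where
  "L_op T w t = (LINT s|lebesgue_on {0..t}. exp (- s / T) * weak_deriv T 1 w s)"

text \<open>
  Finite dimensional subspaces of \<open>H20 T\<close>, given by any set of representatives of their elements:
  linear combinations are therefore taken up to almost everywhere equality.
\<close>

definition fin_dim_subspace :: "real \<Rightarrow> (real \<Rightarrow> real) set \<Rightarrow> bool" where
  "fin_dim_subspace T V \<longleftrightarrow> V \<subseteq> H20 T \<and> V \<noteq> {} \<and>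
     (\<forall>v \<in> V. \<forall>w \<in> V. \<forall>a b. \<exists>z \<in> V. ae_eq T z (\<lambda>t. a * v t + b * w t)) \<and>
     (\<exists>B. finite B \<and> B \<subseteq> V \<and> (\<forall>v \<in> V. \<exists>c. ae_eq T v (\<lambda>t. \<Sum>b\<in>B. c b * b t)))"

text \<open>
  The spaces \<open>S h\<close> are indexed by a set \<open>H\<close> of mesh parameters. It must not be the whole of
  \<open>(0,\<infinity>)\<close>: the inverse inequality implies \<open>h \<le> C_I * T\<close> as soon as \<open>S h\<close> is nontrivial,
  and for \<open>p \<ge> 1\<close> the approximation property forces \<open>S h\<close> to contain the identity function.
\<close>

definition inverse_inequalities ::
  "real \<Rightarrow> real \<Rightarrow> real set \<Rightarrow> (real \<Rightarrow> (real \<Rightarrow> real) set) \<Rightarrow> bool" where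
  "inverse_inequalities T C_I H S \<longleftrightarrow>
     (\<forall>h \<in> H. \<forall>w \<in> S h.
        H20_norm T w \<le> C_I / h * L2_norm T (weak_deriv T 1 w) \<and>
        L2_norm T (weak_deriv T 1 w) \<le> C_I / h * L2_norm T w)"

definition approximation_property ::
  "real \<Rightarrow> nat \<Rightarrow> real \<Rightarrow> real set \<Rightarrow> (real \<Rightarrow> (real \<Rightarrow> real) set) \<Rightarrow> bool" where
  "approximation_property T p C_a H S \<longleftrightarrow>
     (\<forall>h \<in> H. \<forall>s \<le> p. \<forall>w \<in> H20 T \<inter> Hsp T (s + 1). \<exists>wh \<in> S h.
        (\<forall>l \<in> {0, 1, 2}. l \<le> s \<longrightarrow>
           L2_norm T (\<lambda>t. weak_deriv T l w t - weak_deriv T l wh t)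
             \<le> C_a * h ^ (s + 1 - l) * L2_norm T (weak_deriv T (s + 1) w)) \<and>
        (w \<in> Winf T (s + 1) \<longrightarrow>
           Linf_norm T (\<lambda>t. weak_deriv T 1 w t - weak_deriv T 1 wh t)
             \<le> ereal (C_a * h ^ s) * Linf_norm T (weak_deriv T (s + 1) w)))"

definition assumption_A ::
  "real \<Rightarrow> nat \<Rightarrow> real \<Rightarrow> real \<Rightarrow> real set \<Rightarrow> (real \<Rightarrow> (real \<Rightarrow> real) set) \<Rightarrow> bool" where
  "assumption_A T p C_I C_a H S \<longleftrightarrow>
     inverse_inequalities T C_I H S \<and> approximation_property T p C_a H S"

definition is_solution :: "real \<Rightarrow> real \<Rightarrow> (real \<Rightarrow> real) \<Rightarrow> (real \<Rightarrow> real) \<Rightarrow> bool" where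
  "is_solution T \<mu> f u \<longleftrightarrow> u \<in> H20 T \<and>
     (\<forall>w \<in> H20 T. a_form T \<mu> u w = L2_inner T f (weak_deriv T 1 w))"

definition is_discrete_solution ::
  "real \<Rightarrow> real \<Rightarrow> (real \<Rightarrow> real) \<Rightarrow> (real \<Rightarrow> real) set \<Rightarrow> (real \<Rightarrow> real) \<Rightarrow> bool" where
  "is_discrete_solution T \<mu> f V uh \<longleftrightarrow> uh \<in> V \<and>
     (\<forall>w \<in> V. a_form T \<mu> uh (L_op T w) = L2_inner T f (weak_deriv T 1 (L_op T w)))"

end

theory Submission
  imports Defs
begin

text \<open>
  Functions in \<open>H\<^sup>2(0,T)\<close> are iterated primitives up to null sets, so that the form \<open>a\<close>
  can be evaluated on continuous representatives by the product rule. Since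
  \<open>\<partial>\<^sub>t(L\<^sub>T w) = exp (-t/T) \<partial>\<^sub>t w\<close>, integrating \<open>\<partial>\<^sub>t((\<partial>\<^sub>t w)\<^sup>2 exp (-t/T))\<close> and \<open>\<partial>\<^sub>t(w\<^sup>2 exp (-t/T))\<close> shows that
  \<open>a(w, L\<^sub>T w)\<close> dominates \<open>\<parallel>\<partial>\<^sub>t w\<parallel>\<^sup>2 / (2eT) + (\<partial>\<^sub>t w(0))\<^sup>2 / 2\<close>, whereas \<open>a(e, L\<^sub>T w)\<close> is bounded by the
  \<open>H\<^sup>2\<close>-norm of \<open>e\<close>. Galerkin orthogonality and one inverse inequality then give
  \<open>\<parallel>u - u\<^sub>h\<parallel> \<le> (1 + C/h) \<parallel>u - z\<parallel>\<close> for every discrete \<open>z\<close>.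

  For \<open>s \<ge> 2\<close>, \<open>z\<close> comes from the approximation property. For \<open>s = 1\<close> that property does not control
  second derivatives, but \<open>z(t) = \<partial>\<^sub>t u(0) t\<close> is admissible and satisfies \<open>\<parallel>u - z\<parallel> \<le> 2 \<parallel>\<partial>\<^sub>t\<^sup>2 u\<parallel>\<close>. The
  inverse inequality for the identity also yields \<open>h \<le> C\<^sub>I T\<close>.
\<close>

section \<open>Primitives of integrable functions\<close>

lemma finite_measure_M_int: "finite_measure (M_int T)"
  by (rule finite_measure_lebesgue_on) (auto simp: lmeasurable_interval)

lemma AE_M_int_iff: "(AE t in M_int T. P t) \<longleftrightarrow> (AE t in lebesgue. t \<in> {0<..<T} \<longrightarrow> P t)"
  by (rule AE_restrict_space_iff) simp

lemma measurable_M_int_id [measurable]: "(\<lambda>t. t) \<in> borel_measurable (M_int T)"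
  using id_borel_measurable_lebesgue_on by (simp add: id_def)

lemma continuous_on_measurable_M_int:
  assumes "continuous_on {0..T} U"
  shows "U \<in> borel_measurable (M_int T)"
  by (rule continuous_imp_measurable_on_sets_lebesgue)
     (auto intro: continuous_on_subset[OF assms])

text \<open>The primitive is written as an integral over all of (0,T) with a cut-off, not over
  \<open>{0..t}\<close>: the measure then does not depend on \<open>t\<close>, which is the form
  needed for Fubini.\<close>

definition prim :: "real \<Rightarrow> (real \<Rightarrow> real) \<Rightarrow> real \<Rightarrow> real" where
  "prim T g t = (LINT s|M_int T. indicator {..t} s * g s)"

lemma integrable_M_int_cut:
  fixes g :: "real \<Rightarrow> real"
  assumes "integrable (M_int T) g"
  shows "integrable (M_int T) (\<lambda>s. indicator {..t} s * g s)"
proof -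
  have "{0<..<T} \<inter> {..t} \<in> sets (M_int T)"
    by (simp add: sets_restrict_space_iff)
  then have "integrable (M_int T) (\<lambda>s. indicator ({0<..<T} \<inter> {..t}) s *\<^sub>R g s)"
    by (rule integrable_mult_indicator[OF _ assms])
  then show ?thesis
    by (rule Bochner_Integration.integrable_cong[THEN iffD1, OF refl, rotated]) (simp add: indicator_def)
qed

text \<open>Bridge to the Henstock-Kurzweil integral over \<open>{0..t}\<close>, for which
  continuity of indefinite integrals and the fundamental theorem are at hand. The two domains differ
  by at most the points 0, \<open>t\<close> and \<open>T\<close>.\<close>

lemma prim_eq_integral:
  assumes g: "integrable (M_int T) g" and t: "t \<in> {0..T}"
  shows "g absolutely_integrable_on {0..t}" "prim T g t = integral {0..t} g"
proof -
  have "g absolutely_integrable_on {0<..<T}"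
    using g by (simp add: set_integrable_def integrable_restrict_space)
  then have "g absolutely_integrable_on {0..T}"
    by (simp add: absolutely_integrable_on_Icc_iff_Ioo)
  then show *: "g absolutely_integrable_on {0..t}"
    by (rule set_integrable_subset) (use t in auto)
  have "prim T g t = integral {0<..<T} (\<lambda>s. indicator {..t} s * g s)"
    unfolding prim_def by (rule lebesgue_integral_eq_integral[OF integrable_M_int_cut[OF g]]) simp
  also have "\<dots> = integral {0<..<T} (\<lambda>s. if s \<in> {..t} then g s else 0)"
    by (rule arg_cong[where f = "integral _"]) (auto simp: indicator_def)
  also have "\<dots> = integral ({..t} \<inter> {0<..<T}) g"
    by (rule integral_restrict_Int)
  also have "\<dots> = integral {0..t} g"
    by (rule integral_spike_set; rule negligible_subset[of "{0, t, T}"]) (use t in auto)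
  finally show "prim T g t = integral {0..t} g" .
qed

lemma prim_zero [simp]: "T > 0 \<Longrightarrow> integrable (M_int T) g \<Longrightarrow> prim T g 0 = 0"
  using prim_eq_integral(2)[of T g 0] by simp

lemma continuous_on_prim:
  assumes "integrable (M_int T) g"
  shows "continuous_on {0..T} (prim T g)"
proof (cases "T \<ge> 0")
  case True
  have "g absolutely_integrable_on {0..T}"
    using prim_eq_integral[OF assms, of T] True by auto
  then have "continuous_on {0..T} (\<lambda>t. integral {0..t} g)"
    by (intro indefinite_integral_continuous_1) (auto simp: absolutely_integrable_on_def)
  then show ?thesis
    by (rule continuous_on_eq) (simp add: prim_eq_integral[OF assms])
qed simp

lemma prim_top:
  assumes "T \<ge> 0"
  shows "prim T g T = (LINT s|M_int T. g s)"
  unfolding prim_def by (rule Bochner_Integration.integral_cong) (auto simp: indicator_def)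

lemma prim_lincomb:
  assumes "integrable (M_int T) g" "integrable (M_int T) k"
  shows "prim T (\<lambda>s. a * g s + b * k s) t = a * prim T g t + b * prim T k t"
proof -
  have "prim T (\<lambda>s. a * g s + b * k s) t =
    (LINT s|M_int T. a * (indicator {..t} s * g s) + b * (indicator {..t} s * k s))"
    unfolding prim_def by (simp add: algebra_simps)
  then show ?thesis
    unfolding prim_def using assms[THEN integrable_M_int_cut, of t] by simp
qed

lemma prim_cong_AE:
  assumes "integrable (M_int T) g" "integrable (M_int T) k" "ae_eq T g k"
  shows "prim T g t = prim T k t"
  unfolding prim_def
proof (rule integral_cong_AE)
  show "AE s in M_int T. indicator {..t} s * g s = indicator {..t} s * k s"
    using assms(3) unfolding ae_eq_def by eventually_elim simp
qed (use assms(1,2)[THEN integrable_M_int_cut, THEN borel_measurable_integrable] in auto)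

lemma integrable_mult_cont:
  fixes U :: "real \<Rightarrow> real"
  assumes g: "integrable (M_int T) g" and U: "continuous_on {0..T} U"
  shows "integrable (M_int T) (\<lambda>t. U t * g t)"
proof -
  have "bounded (U ` {0..T})"
    by (intro compact_imp_bounded compact_continuous_image U) simp
  then obtain B where B: "\<And>t. t \<in> {0..T} \<Longrightarrow> \<bar>U t\<bar> \<le> B"
    unfolding bounded_iff by fastforce
  show ?thesis
  proof (rule Bochner_Integration.integrable_bound)
    show "integrable (M_int T) (\<lambda>t. B * g t)" using g by simp
    show "(\<lambda>t. U t * g t) \<in> borel_measurable (M_int T)"
      using borel_measurable_integrable[OF g] continuous_on_measurable_M_int[OF U] by simp
    show "AE t in M_int T. norm (U t * g t) \<le> norm (B * g t)"
      by (rule AE_I2) (use B in \<open>auto simp: abs_mult intro!: mult_right_mono order_trans[OF B]\<close>)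
  qed
qed

text \<open>Fubini on the square (0,T) x (0,T), cut along its diagonal: integrating g(x) k(y) over y
  \<le> x yields the first summand, over x < y the second.\<close>

lemma integral_product_split:
  assumes g: "integrable (M_int T) g" and k: "integrable (M_int T) k"
  shows "(LINT s|M_int T. g s) * (LINT s|M_int T. k s)
       = (LINT s|M_int T. g s * prim T k s) + (LINT s|M_int T. k s * prim T g s)"
proof -
  interpret finite_measure "M_int T" by (rule finite_measure_M_int)
  interpret P: pair_sigma_finite "M_int T" "M_int T" ..
  let ?M = "M_int T"
  have [measurable]: "g \<in> borel_measurable ?M" "k \<in> borel_measurable ?M"
    using g k by auto
  let ?F = "\<lambda>(x,y). g x * k y"
  let ?A = "\<lambda>(x,y). indicator {..x} y * (g x * k y)"
  let ?B = "\<lambda>(x,y). indicator {..<y} x * (g x * k y)"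
  have ind: "indicator {..x} y = (if y \<le> x then 1 else 0 :: real)"
    "indicator {..<y} x = (if x < y then 1 else 0 :: real)" for x y :: real
    by (auto simp: indicator_def)
  have F: "integrable (?M \<Otimes>\<^sub>M ?M) ?F"
    by (rule P.Fubini_integrable) (use g k in \<open>auto simp: abs_mult\<close>)
  have A: "integrable (?M \<Otimes>\<^sub>M ?M) ?A"
    by (rule Bochner_Integration.integrable_bound[OF F]) (auto simp: ind)
  have B: "integrable (?M \<Otimes>\<^sub>M ?M) ?B"
    by (rule Bochner_Integration.integrable_bound[OF F]) (auto simp: ind)
  have "(LINT s|?M. g s) * (LINT s|?M. k s) = integral\<^sup>L (?M \<Otimes>\<^sub>M ?M) ?F"
    using P.integral_fst'[OF F] by simp
  also have "\<dots> = integral\<^sup>L (?M \<Otimes>\<^sub>M ?M) (\<lambda>z. ?A z + ?B z)"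
    by (rule Bochner_Integration.integral_cong) (auto simp: indicator_def)
  also have "\<dots> = integral\<^sup>L (?M \<Otimes>\<^sub>M ?M) ?A + integral\<^sup>L (?M \<Otimes>\<^sub>M ?M) ?B"
    by (rule Bochner_Integration.integral_add[OF A B])
  also have "integral\<^sup>L (?M \<Otimes>\<^sub>M ?M) ?A = (LINT x|?M. g x * prim T k x)"
    unfolding P.integral_fst'[OF A, symmetric] prim_def
    by (simp add: mult.left_commute)
  also have "integral\<^sup>L (?M \<Otimes>\<^sub>M ?M) ?B = (LINT y|?M. LINT x|?M. indicator {..<y} x * (g x * k y))"
    using P.integral_snd[of "\<lambda>x y. ?B (x, y)"] B by simp
  also have "\<dots> = (LINT y|?M. k y * prim T g y)"
  proof (rule Bochner_Integration.integral_cong[OF refl])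
    fix y
    \<comment> \<open>The cut-off x < y may be replaced by x \<le> y, as required by
      \<open>prim\<close>, because the single point y is a null set.\<close>
    have "AE x in ?M. x \<noteq> y"
      by (subst AE_M_int_iff) (rule AE_mp[OF AE_not_in[of "{y}"]], auto)
    then have "AE x in ?M. indicator {..<y} x * (g x * k y) = k y * (indicator {..y} x * g x)"
      by eventually_elim (auto simp: indicator_def)
    then have "(LINT x|?M. indicator {..<y} x * (g x * k y)) = (LINT x|?M. k y * (indicator {..y} x * g x))"
      by (intro integral_cong_AE) (auto simp: ind)
    then show "(LINT x|?M. indicator {..<y} x * (g x * k y)) = k y * prim T g y"
      by (simp add: prim_def)
  qed
  finally show ?thesis .
qed

text \<open>Apply \<open>integral_product_split\<close> to both densities cut off at
  \<open>t\<close>. For s \<le> t the inner primitive does not notice the cut-off, and for s > t the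
  outer indicator vanishes.\<close>

lemma prim_mult_prim:
  assumes g: "integrable (M_int T) g" and k: "integrable (M_int T) k"
  shows "prim T g t * prim T k t = prim T (\<lambda>s. g s * prim T k s + prim T g s * k s) t"
proof -
  have *: "indicator {..t} s * a s * prim T (\<lambda>s. indicator {..t} s * b s) s
      = indicator {..t} s * (a s * prim T b s)" for s :: real and a b :: "real \<Rightarrow> real"
  proof (cases "s \<le> t")
    case True
    then have "prim T (\<lambda>s. indicator {..t} s * b s) s = prim T b s"
      unfolding prim_def by (intro Bochner_Integration.integral_cong) (auto simp: indicator_def)
    with True show ?thesis by simp
  qed simp
  have i: "integrable (M_int T) (\<lambda>s. indicator {..t} s * (g s * prim T k s))"
     "integrable (M_int T) (\<lambda>s. indicator {..t} s * (k s * prim T g s))"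
    using integrable_mult_cont[OF g continuous_on_prim[OF k]]
          integrable_mult_cont[OF k continuous_on_prim[OF g]]
    by (intro integrable_M_int_cut; simp add: mult.commute)+
  show ?thesis
    using integral_product_split[OF g[THEN integrable_M_int_cut, of t] k[THEN integrable_M_int_cut, of t]]
      Bochner_Integration.integral_add[OF i]
    unfolding * by (simp add: prim_def algebra_simps)
qed

section \<open>Absolutely continuous functions and their product rule\<close>

text \<open>Absolute continuity on the closed interval, expressed through the integral of the
  derivative: \<open>U\<close> is determined pointwise on \<open>{0..T}\<close>, endpoints included,
  whereas \<open>g\<close> matters only up to null sets.\<close>

definition is_primitive :: "real \<Rightarrow> (real \<Rightarrow> real) \<Rightarrow> (real \<Rightarrow> real) \<Rightarrow> bool" where
  "is_primitive T U g \<longleftrightarrow> integrable (M_int T) g \<and> (\<forall>t\<in>{0..T}. U t = U 0 + prim T g t)"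

lemma is_primitive_integrable: "is_primitive T U g \<Longrightarrow> integrable (M_int T) g"
  by (simp add: is_primitive_def)

lemma is_primitiveD: "is_primitive T U g \<Longrightarrow> t \<in> {0..T} \<Longrightarrow> U t = U 0 + prim T g t"
  unfolding is_primitive_def by blast

lemma is_primitive_continuous:
  assumes "is_primitive T U g"
  shows "continuous_on {0..T} U"
proof -
  have "continuous_on {0..T} (\<lambda>t. U 0 + prim T g t)"
    by (intro continuous_intros continuous_on_prim is_primitive_integrable[OF assms])
  then show ?thesis
    by (rule continuous_on_eq) (rule is_primitiveD[OF assms, symmetric])
qed

lemma is_primitive_prim: "T > 0 \<Longrightarrow> integrable (M_int T) g \<Longrightarrow> is_primitive T (\<lambda>t. c + prim T g t) g"
  by (simp add: is_primitive_def)

lemma is_primitive_cong: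
  assumes "is_primitive T U g" "integrable (M_int T) k" "ae_eq T g k"
  shows "is_primitive T U k"
  unfolding is_primitive_def
proof (intro conjI ballI)
  fix t assume "t \<in> {0..T}"
  then show "U t = U 0 + prim T k t"
    unfolding prim_cong_AE[OF is_primitive_integrable[OF assms(1)] assms(2,3), symmetric]
    by (rule is_primitiveD[OF assms(1)])
qed fact

lemma is_primitive_lincomb:
  assumes "is_primitive T U g" "is_primitive T V k"
  shows "is_primitive T (\<lambda>t. a * U t + b * V t) (\<lambda>t. a * g t + b * k t)"
proof -
  have "a * U t + b * V t = a * U 0 + b * V 0 + prim T (\<lambda>s. a * g s + b * k s) t"
    if "t \<in> {0..T}" for t
    unfolding is_primitiveD[OF assms(1) that] is_primitiveD[OF assms(2) that]
      prim_lincomb[OF assms[THEN is_primitive_integrable]]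
    by (simp add: algebra_simps)
  then show ?thesis
    unfolding is_primitive_def
    by (intro conjI ballI Bochner_Integration.integrable_add integrable_mult_right
        assms[THEN is_primitive_integrable])
qed

lemma is_primitive_mult:
  assumes U: "is_primitive T U g" and V: "is_primitive T V k"
  shows "is_primitive T (\<lambda>t. U t * V t) (\<lambda>t. g t * V t + U t * k t)"
  unfolding is_primitive_def
proof (intro conjI ballI)
  note gk = U[THEN is_primitive_integrable] V[THEN is_primitive_integrable]
  have i: "integrable (M_int T) (\<lambda>s. g s * V s)" "integrable (M_int T) (\<lambda>s. U s * k s)"
    using integrable_mult_cont[OF gk(1) is_primitive_continuous[OF V]]
          integrable_mult_cont[OF gk(2) is_primitive_continuous[OF U]]
    by (simp_all add: mult.commute)
  then show "integrable (M_int T) (\<lambda>t. g t * V t + U t * k t)" by simp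
  have j: "integrable (M_int T) (\<lambda>s. g s * prim T k s + prim T g s * k s)"
    using integrable_mult_cont[OF gk(1) continuous_on_prim[OF gk(2)]]
          integrable_mult_cont[OF gk(2) continuous_on_prim[OF gk(1)]]
    by (simp add: mult.commute)
  have l: "integrable (M_int T) (\<lambda>s. V 0 * g s + U 0 * k s)" using gk by simp
  fix t assume t: "t \<in> {0..T}"
  \<comment> \<open>Writing \<open>U\<close> and \<open>V\<close> as initial value plus primitive
    separates the density of the product of the two primitives from the terms that are linear in
    \<open>g\<close> and \<open>k\<close>.\<close>
  have *: "g s * V s + U s * k s
       = 1 * (g s * prim T k s + prim T g s * k s) + 1 * (V 0 * g s + U 0 * k s)"
    if "s \<in> space (M_int T)" for s
  proof -
    from that have "s \<in> {0..T}" by simp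
    from is_primitiveD[OF U this] is_primitiveD[OF V this]
    show ?thesis by algebra
  qed
  have "prim T (\<lambda>t. g t * V t + U t * k t) t
    = prim T (\<lambda>s. 1 * (g s * prim T k s + prim T g s * k s) + 1 * (V 0 * g s + U 0 * k s)) t"
    unfolding prim_def[of T _ t] by (rule Bochner_Integration.integral_cong[OF refl]) (simp only: *)
  also have "\<dots> = prim T g t * prim T k t + (V 0 * prim T g t + U 0 * prim T k t)"
    unfolding prim_lincomb[OF j l] prim_lincomb[OF gk] prim_mult_prim[OF gk] by simp
  finally show "U t * V t = U 0 * V 0 + prim T (\<lambda>t. g t * V t + U t * k t) t"
    using is_primitiveD[OF U t] is_primitiveD[OF V t] by algebra
qed

lemma is_primitive_integral_eq:
  assumes "is_primitive T U g" "T \<ge> 0"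
  shows "(LINT t|M_int T. g t) = U T - U 0"
  using is_primitiveD[OF assms(1), of T] assms(2) by (simp add: prim_top)

lemma is_primitive_C1:
  assumes d: "\<And>t. t \<in> {0..T} \<Longrightarrow> (F has_real_derivative f t) (at t within {0..T})"
    and c: "continuous_on {0..T} f"
  shows "is_primitive T F f"
proof -
  interpret finite_measure "M_int T" by (rule finite_measure_M_int)
  have int: "integrable (M_int T) f"
    using integrable_mult_cont[of T "\<lambda>_. 1" f] c by simp
  moreover have "F t = F 0 + prim T f t" if t: "t \<in> {0..T}" for t
  proof -
    have "(f has_integral F t - F 0) {0..t}"
      by (rule fundamental_theorem_of_calculus)
        (use t in \<open>auto simp flip: has_real_derivative_iff_has_vector_derivative
           intro!: has_field_derivative_subset[OF d]\<close>)
    then show ?thesis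
      using prim_eq_integral[OF int t] by (simp add: integral_unique)
  qed
  ultimately show ?thesis unfolding is_primitive_def by blast
qed

section \<open>The fundamental lemma of the calculus of variations\<close>

lemma tendsto_inverse_Suc: "(\<lambda>n. 1 / (real n + 1)) \<longlonglongrightarrow> 0"
  using LIMSEQ_inverse_real_of_nat by (simp add: inverse_eq_divide add.commute)

lemma eventually_in_shrunk_interval:
  assumes "0 < x" "x < T"
  shows "\<forall>\<^sub>F n in sequentially. 1 / (real n + 1) < x \<and> x < T - 1 / (real n + 1)"
  using order_tendstoD(2)[OF tendsto_inverse_Suc, of x]
    order_tendstoD(2)[OF tendsto_inverse_Suc, of "T - x"] assms
  by (auto elim: eventually_elim2)

text \<open>Local integrability gives measurability only on compact subintervals. Truncations of
  \<open>u\<close> to intervals exhausting (0,T) converge pointwise to \<open>u\<close>, because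
  each point is eventually inside.\<close>

lemma loc_integrable_measurable:
  assumes "loc_integrable T u"
  shows "u \<in> borel_measurable (M_int T)"
proof -
  define e where "e n = 1 / (real n + 1)" for n
  define f where "f n x = (if x \<in> {e n..T - e n} then u x else 0)" for n x
  have "f n \<in> borel_measurable lebesgue" for n
  proof -
    have "integrable (lebesgue_on {e n..T - e n}) u"
      using assms by (simp add: loc_integrable_def e_def)
    from borel_measurable_integrable[OF this] show ?thesis
      unfolding f_def by (subst borel_measurable_if) auto
  qed
  then have "f n \<in> borel_measurable (M_int T)" for n
    by (rule measurable_restrict_space1)
  moreover have "(\<lambda>n. f n x) \<longlonglongrightarrow> u x" if "x \<in> space (M_int T)" for x
  proof (rule tendsto_eventually)
    show "\<forall>\<^sub>F n in sequentially. f n x = u x"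
      using that
      by (intro eventually_mono[OF eventually_in_shrunk_interval[of x T]]) (auto simp: f_def e_def)
  qed
  ultimately show ?thesis
    by (rule borel_measurable_LIMSEQ_real[rotated])
qed

section \<open>Compactly supported test functions\<close>

lemma test_funE:
  assumes "\<phi> \<in> test_fun T"
  obtains a b where "0 < a" "b < T" "\<And>t. (\<phi> has_real_derivative deriv \<phi> t) (at t)"
    "continuous_on UNIV \<phi>" "continuous_on UNIV (deriv \<phi>)"
    "\<And>t. t \<notin> {a..b} \<Longrightarrow> \<phi> t = 0" "\<And>t. t \<notin> {a..b} \<Longrightarrow> deriv \<phi> t = 0"
proof -
  from assms obtain D a b where D: "\<And>t. (\<phi> has_vector_derivative D t) (at t)"
    and cD: "continuous_on UNIV D" and ab: "0 < a" "b < T" "\<And>t. t \<notin> {a..b} \<Longrightarrow> \<phi> t = 0"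
    unfolding test_fun_def C1_differentiable_on_def by auto
  have d: "(\<phi> has_real_derivative D t) (at t)" for t
    using D by (simp add: has_real_derivative_iff_has_vector_derivative)
  then have eq: "deriv \<phi> = D" by (auto intro!: DERIV_imp_deriv)
  have "D t = 0" if "t \<notin> {a..b}" for t
  proof (rule DERIV_unique[OF d])
    show "(\<phi> has_real_derivative 0) (at t)"
      by (rule has_field_derivative_transform_within_open[where f = "\<lambda>_. 0" and S = "- {a..b}"])
         (use that ab(3) in auto)
  qed
  moreover have "continuous_on UNIV \<phi>"
    using d by (meson DERIV_isCont continuous_at_imp_continuous_on)
  ultimately show thesis using that[of a b] ab d cD unfolding eq by blast
qed

lemma test_funI:
  assumes d: "\<And>t. (\<phi> has_real_derivative \<phi>' t) (at t)" and c: "continuous_on UNIV \<phi>'"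
    and "0 < a" "b < T" "\<And>t. t \<notin> {a..b} \<Longrightarrow> \<phi> t = 0"
  shows "\<phi> \<in> test_fun T" "deriv \<phi> = \<phi>'"
proof -
  have "\<phi> C1_differentiable_on UNIV"
    unfolding C1_differentiable_on_def
    using d c by (auto simp: has_real_derivative_iff_has_vector_derivative)
  then show "\<phi> \<in> test_fun T" unfolding test_fun_def using assms(3-) by blast
  show "deriv \<phi> = \<phi>'" using d by (auto intro!: DERIV_imp_deriv)
qed

lemma integrable_compact_support:
  fixes u \<phi> :: "real \<Rightarrow> real"
  assumes u: "integrable (lebesgue_on {a..b}) u" and c: "continuous_on UNIV \<phi>"
    and z: "\<And>t. t \<notin> {a..b} \<Longrightarrow> \<phi> t = 0"
  shows "integrable lebesgue (\<lambda>t. u t * \<phi> t)"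
proof -
  have "bounded (\<phi> ` {a..b})"
    by (intro compact_imp_bounded compact_continuous_image continuous_on_subset[OF c]) auto
  then obtain B where B: "\<And>t. t \<in> {a..b} \<Longrightarrow> \<bar>\<phi> t\<bar> \<le> B"
    unfolding bounded_iff by fastforce
  have "integrable (lebesgue_on {a..b}) (\<lambda>t. u t * \<phi> t)"
  proof (rule Bochner_Integration.integrable_bound)
    show "integrable (lebesgue_on {a..b}) (\<lambda>t. B * u t)" using u by simp
    have "\<phi> \<in> borel_measurable (lebesgue_on {a..b})"
      by (rule continuous_imp_measurable_on_sets_lebesgue) (auto intro: continuous_on_subset[OF c])
    then show "(\<lambda>t. u t * \<phi> t) \<in> borel_measurable (lebesgue_on {a..b})"
      using borel_measurable_integrable[OF u] by simp
    show "AE t in lebesgue_on {a..b}. norm (u t * \<phi> t) \<le> norm (B * u t)"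
    proof (rule AE_I2)
      fix t assume "t \<in> space (lebesgue_on {a..b})"
      then have "\<bar>\<phi> t\<bar> \<le> \<bar>B\<bar>" using B[of t] by auto
      then show "norm (u t * \<phi> t) \<le> norm (B * u t)"
        by (simp add: abs_mult mult.commute[of "\<bar>u t\<bar>"] mult_right_mono)
    qed
  qed
  then have "integrable lebesgue (\<lambda>t. indicator {a..b} t *\<^sub>R (u t * \<phi> t))"
    by (simp add: integrable_restrict_space)
  moreover have "(\<lambda>t. indicator {a..b} t *\<^sub>R (u t * \<phi> t)) = (\<lambda>t. u t * \<phi> t)"
    using z by (auto simp: indicator_def fun_eq_iff)
  ultimately show ?thesis by simp
qed

lemma integrable_lebesgue_M_int:
  fixes f :: "real \<Rightarrow> real"
  assumes "integrable lebesgue f"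
  shows "integrable (M_int T) f"
  using integrable_mult_indicator[OF _ assms, of "{0<..<T}"] by (simp add: integrable_restrict_space)

lemma integral_M_int_compact_support:
  fixes f :: "real \<Rightarrow> real"
  assumes "0 < a" "b < T" "\<And>t. t \<notin> {a..b} \<Longrightarrow> f t = 0"
  shows "(LINT t|M_int T. f t) = (LINT t|lebesgue. f t)"
proof -
  have "indicator {0<..<T} t *\<^sub>R f t = f t" for t
    using assms by (cases "t \<in> {a..b}") (auto simp: indicator_def)
  then show ?thesis by (simp add: integral_restrict_space del: real_scaleR_def)
qed

text \<open>The squared positive part is the C1 building block of the bump functions below; at 0 its
  difference quotient is bounded by |h|.\<close>

lemma DERIV_max_zero_square: "((\<lambda>t::real. (max 0 t)\<^sup>2) has_real_derivative 2 * max 0 t) (at t)"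
proof (cases t "0::real" rule: linorder_cases)
  case less
  show ?thesis
    by (rule has_field_derivative_transform_within_open[where f = "\<lambda>_. 0" and S = "{..<0}"])
      (use less in auto)
next
  case greater
  show ?thesis
    by (rule has_field_derivative_transform_within_open[where f = "\<lambda>x. x\<^sup>2" and S = "{0<..}"])
      (use greater in \<open>auto intro!: derivative_eq_intros\<close>)
next
  case equal
  have "((\<lambda>t::real. (max 0 t)\<^sup>2) has_real_derivative 0) (at 0)"
    unfolding DERIV_def
  proof (rule Lim_null_comparison)
    show "\<forall>\<^sub>F h in at 0. norm (((max 0 (0 + h))\<^sup>2 - (max 0 0)\<^sup>2) / h) \<le> \<bar>h :: real\<bar>"
      by (rule always_eventually) (auto simp: max_def power2_eq_square)
    show "((\<lambda>h. \<bar>h :: real\<bar>) \<longlongrightarrow> 0) (at 0)"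
      by (rule tendsto_rabs_zero) simp
  qed
  then show ?thesis using equal by simp
qed

text \<open>With r the product of the squared positive parts of t - a and b - t, the functions n r /
  (1 + n r) are C1, take values in [0,1), vanish where r does, and tend to 1 where r > 0. For a
  \<ge> b everything is zero.\<close>

lemma test_fun_approx_indicator:
  assumes "0 < a" "b < T"
  obtains \<phi> :: "nat \<Rightarrow> real \<Rightarrow> real" where
    "\<And>n. \<phi> n \<in> test_fun T" "\<And>n t. \<bar>\<phi> n t\<bar> \<le> indicator {a<..<b} t"
    "\<And>t. (\<lambda>n. \<phi> n t) \<longlonglongrightarrow> indicator {a<..<b} t"
proof -
  define r where "r t = (max 0 (t - a))\<^sup>2 * (max 0 (b - t))\<^sup>2" for t
  define r' where "r' t = 2 * max 0 (t - a) * (max 0 (b - t))\<^sup>2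
      - (max 0 (t - a))\<^sup>2 * (2 * max 0 (b - t))" for t
  define \<phi> where "\<phi> n t = real n * r t / (1 + real n * r t)" for n t
  define \<phi>' where "\<phi>' n t = real n * r' t / (1 + real n * r t)\<^sup>2" for n t
  have r0: "r t \<ge> 0" for t by (simp add: r_def)
  have pos: "1 + real n * r t > 0" for n t using r0[of t] by (simp add: add_pos_nonneg)
  have c: "continuous_on UNIV r" "continuous_on UNIV r'"
    unfolding r_def r'_def by (intro continuous_intros)+
  have dr: "(r has_real_derivative r' t) (at t)" for t
    unfolding r_def r'_def
    by (rule derivative_eq_intros DERIV_chain'[OF _ DERIV_max_zero_square] refl | simp)+
  have d: "(\<phi> n has_real_derivative \<phi>' n t) (at t)" for n t
    unfolding \<phi>_def \<phi>'_def using pos[of n t]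
    by (auto intro!: derivative_eq_intros dr simp: field_simps power2_eq_square)
  have zero: "r t = 0" if "t \<notin> {a<..<b}" for t
    using that by (auto simp: r_def not_less)
  have rpos: "r t > 0" if "t \<in> {a<..<b}" for t
    using that by (auto simp: r_def)
  show thesis
  proof (rule that[of \<phi>])
    fix n
    have "continuous_on UNIV (\<phi>' n)"
      unfolding \<phi>'_def using pos[of n]
      by (intro continuous_intros c) (auto simp: less_imp_neq[symmetric])
    moreover have "\<phi> n t = 0" if "t \<notin> {a..b}" for t
      using that zero[of t] by (auto simp: \<phi>_def)
    ultimately show "\<phi> n \<in> test_fun T"
      using d assms by (intro test_funI(1)[of "\<phi> n" "\<phi>' n" a b]) auto
  next
    fix n t
    show "\<bar>\<phi> n t\<bar> \<le> indicator {a<..<b} t"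
      using pos[of n t] r0[of t] zero[of t]
      by (cases "t \<in> {a<..<b}") (auto simp: \<phi>_def field_simps abs_of_nonneg)
  next
    fix t
    show "(\<lambda>n. \<phi> n t) \<longlonglongrightarrow> indicator {a<..<b} t"
    proof (cases "t \<in> {a<..<b}")
      case True
      then have "r t > 0" by (rule rpos)
      then have "(\<lambda>n. \<phi> n t) \<longlonglongrightarrow> 1"
        unfolding \<phi>_def by real_asymp
      with True show ?thesis by simp
    next
      case False
      then show ?thesis by (simp add: \<phi>_def zero)
    qed
  qed
qed

text \<open>The positive and negative parts of such a function are densities of measures that agree on
  all half-lines.\<close>

lemma AE_zero_if_integral_halflines_zero:
  fixes K :: "real \<Rightarrow> real"
  assumes K: "integrable lebesgue K"
    and z: "\<And>x. (LINT t|lebesgue. indicator {x<..} t * K t) = 0"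
  shows "AE t in lebesgue. K t = 0"
proof -
  \<comment> \<open>A Borel representative is needed because the uniqueness theorem for measures
    agreeing on half-lines concerns measures on the Borel sets.\<close>
  obtain K' where K' [measurable]: "K' \<in> borel_measurable lborel"
    and ae: "AE t in lborel. K t = K' t"
    using completion_ex_borel_measurable_real[OF borel_measurable_integrable[OF K]] by auto
  have ae': "AE t in lebesgue. K t = K' t" using ae by (rule AE_completion)
  have K'm: "K' \<in> borel_measurable lebesgue" using K' by (rule measurable_completion)
  have "integrable lebesgue K'"
    by (rule integrable_cong_AE_imp[OF K K'm]) (use ae' in auto)
  then have I: "integrable lborel K'" using integrable_completion[OF K'] by simp
  have J: "integrable lborel (\<lambda>t. indicator {x<..} t * K' t)" for x
    using integrable_mult_indicator[of "{x<..}" lborel K'] I by simp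
  have z': "(LINT t|lborel. indicator {x<..} t * K' t) = 0" for x
  proof -
    have "(LINT t|lborel. indicator {x<..} t * K' t) = (LINT t|lebesgue. indicator {x<..} t * K' t)"
      by (rule integral_completion[symmetric]) measurable
    also have "\<dots> = (LINT t|lebesgue. indicator {x<..} t * K t)"
    proof (rule integral_cong_AE)
      show "(\<lambda>t. indicator {x<..} t * K' t) \<in> borel_measurable lebesgue"
        by (rule measurable_completion) measurable
      show "(\<lambda>t. indicator {x<..} t * K t) \<in> borel_measurable lebesgue"
        using K by (intro borel_measurable_times borel_measurable_indicator) auto
      show "AE t in lebesgue. indicator {x<..} t * K' t = indicator {x<..} t * K t"
        using ae' by eventually_elim simp
    qed
    finally show ?thesis using z by simp
  qed
  have fin: "(\<integral>\<^sup>+t. ennreal (indicator {x<..} t * K' t) \<partial>lborel) \<noteq> \<infinity>"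
    "(\<integral>\<^sup>+t. ennreal (- (indicator {x<..} t * K' t)) \<partial>lborel) \<noteq> \<infinity>" for x
    using J[of x] by (auto simp: real_integrable_def)
  have eq: "(\<integral>\<^sup>+t. ennreal (indicator {x<..} t * K' t) \<partial>lborel)
       = (\<integral>\<^sup>+t. ennreal (- (indicator {x<..} t * K' t)) \<partial>lborel)" for x
  proof -
    have fin': "a = b" if "a \<noteq> \<infinity>" "b \<noteq> \<infinity>" "enn2real a - enn2real b = 0" for a b
      using that by (cases a; cases b) auto
    show ?thesis
      by (rule fin'[OF fin]) (use real_lebesgue_integral_def[OF J[of x]] z'[of x] in linarith)
  qed
  have mult: "ennreal (K' t) * indicator {x<..} t = ennreal (indicator {x<..} t * K' t)"
    "ennreal (- K' t) * indicator {x<..} t = ennreal (- (indicator {x<..} t * K' t))" for x t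
    by (auto simp: indicator_def)
  have "density lborel (\<lambda>t. ennreal (K' t)) = density lborel (\<lambda>t. ennreal (- K' t))"
  proof (rule measure_eqI_lessThan)
    fix x
    show "emeasure (density lborel (\<lambda>t. ennreal (K' t))) {x<..} < \<infinity>"
      using fin(1)[of x] by (simp add: emeasure_density mult less_top)
    show "emeasure (density lborel (\<lambda>t. ennreal (K' t))) {x<..}
        = emeasure (density lborel (\<lambda>t. ennreal (- K' t))) {x<..}"
      using eq[of x] by (simp add: emeasure_density mult)
  qed auto
  then have "AE t in lborel. ennreal (K' t) = ennreal (- K' t)"
    by (intro sigma_finite_measure.density_unique[OF sigma_finite_lborel]) auto
  then have "AE t in lborel. K' t = 0"
  proof eventually_elim
    \<comment> \<open>\<open>ennreal\<close> truncates negative reals to 0, so one of the two sides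
      is 0; hence both are, and \<open>K' t\<close> is neither positive nor negative.\<close>
    fix t assume *: "ennreal (K' t) = ennreal (- K' t)"
    show "K' t = 0"
    proof (cases "K' t \<ge> 0")
      case True
      then have "ennreal (- K' t) = 0" by (simp add: ennreal_neg)
      with * have "ennreal (K' t) = 0" by metis
      then show ?thesis using True by (simp add: ennreal_eq_0_iff)
    next
      case False
      then have "ennreal (K' t) = 0" by (simp add: ennreal_neg)
      with * have "ennreal (- K' t) = 0" by metis
      then show ?thesis using False by (simp add: ennreal_eq_0_iff)
    qed
  qed
  then have "AE t in lebesgue. K' t = 0" by (rule AE_completion)
  with ae' show ?thesis by eventually_elim simp
qed

text \<open>Testing with functions that tend to the indicator of (a,b), dominated convergence shows
  that \<open>k\<close> has integral zero over every interval compactly contained in (0,T). This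
  forces \<open>k\<close> to vanish almost everywhere on each of them, and countably many exhaust
  (0,T).\<close>

lemma fundamental_lemma_variations:
  assumes k: "loc_integrable T k"
    and z: "\<And>\<phi>. \<phi> \<in> test_fun T \<Longrightarrow> (LINT t|M_int T. k t * \<phi> t) = 0"
  shows "ae_eq T k (\<lambda>_. 0)"
proof -
  have int: "integrable lebesgue (\<lambda>t. indicator {a<..<b} t * k t)" if "0 < a" "b < T" for a b
  proof -
    have "integrable lebesgue (\<lambda>t. indicator {a..b} t *\<^sub>R k t)"
      using k that by (simp add: loc_integrable_def integrable_restrict_space)
    then have "integrable lebesgue (\<lambda>t. indicator {a<..<b} t *\<^sub>R indicator {a..b} t *\<^sub>R k t)"
      by (rule integrable_mult_indicator[rotated]) simp
    also have "(\<lambda>t. indicator {a<..<b} t *\<^sub>R indicator {a..b} t *\<^sub>R k t) = (\<lambda>t. indicator {a<..<b} t * k t)"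
      by (auto simp: indicator_def)
    finally show ?thesis .
  qed
  have zero: "(LINT t|lebesgue. indicator {a<..<b} t * k t) = 0" if ab: "0 < a" "b < T" for a b
  proof -
    obtain \<phi> :: "nat \<Rightarrow> real \<Rightarrow> real" where \<phi>:
      "\<And>n. \<phi> n \<in> test_fun T" "\<And>n t. \<bar>\<phi> n t\<bar> \<le> indicator {a<..<b} t"
      "\<And>t. (\<lambda>n. \<phi> n t) \<longlonglongrightarrow> indicator {a<..<b} t"
      using test_fun_approx_indicator[OF ab] by metis
    have \<phi>0: "\<phi> n t = 0" if "t \<notin> {a..b}" for n t
      using \<phi>(2)[of n t] that by (auto simp: indicator_def split: if_splits)
    have kint: "integrable (lebesgue_on {a..b}) k"
      using k ab by (simp add: loc_integrable_def)
    have cont: "continuous_on UNIV (\<phi> n)" for n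
      by (rule test_funE[OF \<phi>(1)[of n]])
    have "(\<lambda>n. LINT t|lebesgue. k t * \<phi> n t) \<longlonglongrightarrow> (LINT t|lebesgue. indicator {a<..<b} t * k t)"
    proof (rule integral_dominated_convergence)
      show "integrable lebesgue (\<lambda>t. \<bar>indicator {a<..<b} t * k t\<bar>)"
        using int[OF ab] by simp
      show "(\<lambda>t. indicator {a<..<b} t * k t) \<in> borel_measurable lebesgue"
        using int[OF ab] by simp
      show "(\<lambda>t. k t * \<phi> n t) \<in> borel_measurable lebesgue" for n
        using integrable_compact_support[OF kint cont \<phi>0] by auto
      show "AE t in lebesgue. (\<lambda>n. k t * \<phi> n t) \<longlonglongrightarrow> indicator {a<..<b} t * k t"
        by (rule AE_I2) (auto intro!: tendsto_eq_intros \<phi>(3))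
      show "AE t in lebesgue. norm (k t * \<phi> n t) \<le> \<bar>indicator {a<..<b} t * k t\<bar>" for n
      proof (rule AE_I2)
        fix t
        show "norm (k t * \<phi> n t) \<le> \<bar>indicator {a<..<b} t * k t\<bar>"
          using mult_left_mono[OF \<phi>(2)[of n t], of "\<bar>k t\<bar>"]
          by (simp add: abs_mult mult.commute)
      qed
    qed
    moreover have "(LINT t|lebesgue. k t * \<phi> n t) = 0" for n
      using z[OF \<phi>(1)[of n]] integral_M_int_compact_support[of a b T "\<lambda>t. k t * \<phi> n t"] ab \<phi>0
      by simp
    ultimately show ?thesis by (simp add: LIMSEQ_const_iff)
  qed
  have "AE t in lebesgue. indicator {a<..<b} t * k t = 0" if ab: "0 < a" "b < T" for a b
  proof (rule AE_zero_if_integral_halflines_zero[OF int[OF ab]])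
    fix x
    \<comment> \<open>Intersecting (a,b) with a half-line gives an interval of the same kind, so the
      half-line condition reduces to \<open>zero\<close>.\<close>
    have "(\<lambda>t. indicator {x<..} t * (indicator {a<..<b} t * k t)) = (\<lambda>t. indicator {max x a<..<b} t * k t)"
      by (auto simp: indicator_def)
    then show "(LINT t|lebesgue. indicator {x<..} t * (indicator {a<..<b} t * k t)) = 0"
      using zero[of "max x a" b] ab by simp
  qed
  then have "AE t in lebesgue. \<forall>n. indicator {1 / (real n + 1)<..<T - 1 / (real n + 1)} t * k t = 0"
    by (subst AE_all_countable) auto
  then have "AE t in lebesgue. t \<in> {0<..<T} \<longrightarrow> k t = 0"
  proof eventually_elim
    fix t assume *: "\<forall>n. indicator {1 / (real n + 1)<..<T - 1 / (real n + 1)} t * k t = 0"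
    show "t \<in> {0<..<T} \<longrightarrow> k t = 0"
    proof
      assume "t \<in> {0<..<T}"
      then have "\<forall>\<^sub>F n in sequentially. 1 / (real n + 1) < t \<and> t < T - 1 / (real n + 1)"
        by (intro eventually_in_shrunk_interval) auto
      then obtain n where "1 / (real n + 1) < t \<and> t < T - 1 / (real n + 1)"
        by (auto dest: eventually_happens)
      with *[rule_format, of n] show "k t = 0" by (simp add: indicator_def)
    qed
  qed
  then show ?thesis by (simp add: ae_eq_def AE_M_int_iff)
qed

section \<open>Weak derivatives and continuous representatives\<close>

lemma loc_integrable_lincomb:
  assumes "loc_integrable T u" "loc_integrable T v"
  shows "loc_integrable T (\<lambda>t. a * u t + b * v t)"
  using assms unfolding loc_integrable_def by simp

lemma integrable_imp_loc_integrable: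
  assumes "integrable (M_int T) u"
  shows "loc_integrable T u"
  unfolding loc_integrable_def
proof (intro allI impI)
  fix a b :: real assume ab: "0 < a \<and> b < T"
  have "integrable lebesgue (\<lambda>t. indicator {0<..<T} t *\<^sub>R u t)"
    using assms by (subst (asm) integrable_restrict_space) auto
  then have "integrable lebesgue (\<lambda>t. indicator {a..b} t *\<^sub>R indicator {0<..<T} t *\<^sub>R u t)"
    by (rule integrable_mult_indicator[rotated]) simp
  also have "(\<lambda>t. indicator {a..b} t *\<^sub>R indicator {0<..<T} t *\<^sub>R u t) = (\<lambda>t. indicator {a..b} t *\<^sub>R u t)"
    using ab by (auto simp: indicator_def fun_eq_iff)
  finally show "integrable (lebesgue_on {a..b}) u"
    by (subst integrable_restrict_space) auto
qed

lemma integrable_times_test_fun: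
  assumes u: "loc_integrable T u" and \<phi>: "\<phi> \<in> test_fun T"
  shows "integrable (M_int T) (\<lambda>t. u t * \<phi> t)" "integrable (M_int T) (\<lambda>t. u t * deriv \<phi> t)"
proof -
  obtain a b where ab: "0 < a" "b < T" "continuous_on UNIV \<phi>" "continuous_on UNIV (deriv \<phi>)"
    "\<And>t. t \<notin> {a..b} \<Longrightarrow> \<phi> t = 0" "\<And>t. t \<notin> {a..b} \<Longrightarrow> deriv \<phi> t = 0"
    by (rule test_funE[OF \<phi>]) blast
  have "integrable (lebesgue_on {a..b}) u" using u ab by (simp add: loc_integrable_def)
  then show "integrable (M_int T) (\<lambda>t. u t * \<phi> t)" "integrable (M_int T) (\<lambda>t. u t * deriv \<phi> t)"
    using ab(3-) by (blast intro: integrable_lebesgue_M_int integrable_compact_support)+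
qed

lemma is_weak_deriv_unique:
  assumes "is_weak_deriv T u g" "is_weak_deriv T u k"
  shows "ae_eq T g k"
proof -
  have gk: "loc_integrable T g" "loc_integrable T k" using assms by (auto simp: is_weak_deriv_def)
  have "ae_eq T (\<lambda>t. 1 * g t + (-1) * k t) (\<lambda>_. 0)"
  proof (rule fundamental_lemma_variations)
    show "loc_integrable T (\<lambda>t. 1 * g t + (-1) * k t)"
      by (rule loc_integrable_lincomb[OF gk])
    fix \<phi> assume \<phi>: "\<phi> \<in> test_fun T"
    have "(LINT t|M_int T. u t * deriv \<phi> t) = - (LINT t|M_int T. g t * \<phi> t)"
      "(LINT t|M_int T. u t * deriv \<phi> t) = - (LINT t|M_int T. k t * \<phi> t)"
      using assms \<phi> unfolding is_weak_deriv_def by blast+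
    then have "(LINT t|M_int T. g t * \<phi> t) = (LINT t|M_int T. k t * \<phi> t)" by linarith
    then show "(LINT t|M_int T. (1 * g t + (-1) * k t) * \<phi> t) = 0"
      using gk[THEN integrable_times_test_fun(1)[OF _ \<phi>]] by (simp add: algebra_simps)
  qed
  then show ?thesis by (simp add: ae_eq_def)
qed

text \<open>The zero mean is exactly what makes the primitive vanish to the right of the support of
  \<eta> as well as to the left.\<close>

lemma test_fun_primitive:
  assumes c: "continuous_on UNIV \<eta>" and ab: "0 < a" "b < T"
    and z: "\<And>t. t \<notin> {a..b} \<Longrightarrow> \<eta> t = 0" and I: "(LINT t|M_int T. \<eta> t) = 0"
  shows "\<exists>\<Phi>\<in>test_fun T. deriv \<Phi> = \<eta>"
proof (cases "a \<le> b")
  case True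
  define \<Phi> where "\<Phi> t = integral {0..t} \<eta>" for t
  have cI: "continuous_on S \<eta>" for S using c continuous_on_subset by blast
  have 0: "\<Phi> t = 0" if "t < a" for t
  proof -
    have "\<Phi> t = integral {0..t} (\<lambda>_. 0 :: real)"
      unfolding \<Phi>_def by (rule Henstock_Kurzweil_Integration.integral_cong) (use that z in auto)
    then show ?thesis by simp
  qed
  have J: "\<Phi> t = integral {a..b} \<eta>" if "b \<le> t" for t
    unfolding \<Phi>_def
  proof (rule integral_unique, rule has_integral_on_superset)
    show "(\<eta> has_integral integral {a..b} \<eta>) {a..b}"
      by (intro integrable_integral integrable_continuous_real cI)
  qed (use ab that z in auto)
  have int: "integrable (M_int T) \<eta>"
    using integrable_lebesgue_M_int[OF integrable_compact_support[of a b "\<lambda>_. 1", OF _ c z]]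
      finite_measure.integrable_const[OF finite_measure_lebesgue_on[of "{a..b}"]]
    by (simp add: lmeasurable_interval)
  have "integral {a..b} \<eta> = 0"
    using J[of T] prim_eq_integral(2)[OF int, of T] prim_top[of T \<eta>] I ab True
    by (simp add: \<Phi>_def)
  then have zero: "\<Phi> t = 0" if "t \<notin> {a..b}" for t
    using 0[of t] J[of t] that by force
  have "(\<Phi> has_real_derivative \<eta> t) (at t)" for t
  proof (cases "t < a")
    case True
    then have "((\<lambda>_. 0) has_real_derivative \<eta> t) (at t)" using z[of t] by simp
    then show ?thesis
      by (rule has_field_derivative_transform_within_open[where S = "{..<a}"]) (use 0 True in auto)
  next
    case False
    then have t: "0 < t" using ab by simp
    have "(\<Phi> has_vector_derivative \<eta> t) (at t within {0..t + 1})"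
      unfolding \<Phi>_def by (rule integral_has_vector_derivative[OF cI]) (use t in auto)
    moreover have "at t within {0..t + 1} = at t"
      by (rule at_within_interior) (use t in auto)
    ultimately show ?thesis by (simp add: has_real_derivative_iff_has_vector_derivative)
  qed
  from test_funI[OF this c ab zero] show ?thesis by blast
next
  \<comment> \<open>Here the support interval is empty and \<eta> is identically zero.\<close>
  case False
  then have "\<eta> t = 0" for t using z[of t] by auto
  then show ?thesis
    using test_funI[of "\<lambda>_. 0" \<eta>, OF _ c ab] by (intro bexI[of _ "\<lambda>_. 0"]) auto
qed

text \<open>A way of saying that (0,T) is not a null set, in the form in which it contradicts almost
  everywhere identities.\<close>

lemma not_ae_eq_one_zero:
  assumes "T > 0"
  shows "\<not> ae_eq T (\<lambda>_. 1) (\<lambda>_. 0)"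
proof
  assume "ae_eq T (\<lambda>_. 1) (\<lambda>_. 0)"
  then have "AE t in lebesgue. t \<notin> {0<..<T}" by (auto simp: ae_eq_def AE_M_int_iff)
  then have "emeasure lebesgue {0<..<T} = 0" by (subst (asm) AE_iff_null_sets[symmetric]) auto
  then show False using assms by simp
qed

text \<open>Du Bois-Reymond: fix a test function \<psi> with nonzero integral. Every test function
  is a multiple of \<psi> plus the derivative of a test function, and \<open>u\<close> annihilates
  the latter; so \<open>u\<close> acts on test functions like a constant.\<close>

lemma weak_deriv_zero_imp_const:
  assumes T: "T > 0" and u: "loc_integrable T u"
    and z: "\<And>\<phi>. \<phi> \<in> test_fun T \<Longrightarrow> (LINT t|M_int T. u t * deriv \<phi> t) = 0"
  shows "\<exists>c. ae_eq T u (\<lambda>_. c)"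
proof -
  have one: "loc_integrable T (\<lambda>_. 1)"
    by (intro integrable_imp_loc_integrable finite_measure.integrable_const finite_measure_M_int)
  \<comment> \<open>If all test functions had integral zero, the fundamental lemma would make the
    constant 1 vanish almost everywhere.\<close>
  obtain \<psi> where \<psi>: "\<psi> \<in> test_fun T" and I: "(LINT t|M_int T. \<psi> t) \<noteq> 0"
    using fundamental_lemma_variations[OF one] not_ae_eq_one_zero[OF T] by auto
  define I where "I = (LINT t|M_int T. \<psi> t)"
  \<comment> \<open>The mean of \<open>u\<close> weighted by \<psi>, the only constant compatible
    with testing against \<psi> itself.\<close>
  define c where "c = (LINT t|M_int T. u t * \<psi> t) / I"
  have "ae_eq T (\<lambda>t. 1 * u t + (-c) * 1) (\<lambda>_. 0)"
  proof (rule fundamental_lemma_variations)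
    show "loc_integrable T (\<lambda>t. 1 * u t + (-c) * 1)"
      by (rule loc_integrable_lincomb[OF u one])
    fix \<phi> assume \<phi>: "\<phi> \<in> test_fun T"
    define d where "d = (LINT t|M_int T. \<phi> t) / I"
    note i = integrable_times_test_fun[OF one \<phi>] integrable_times_test_fun[OF one \<psi>]
    note j = integrable_times_test_fun[OF u \<phi>] integrable_times_test_fun[OF u \<psi>]
    obtain a b where ab: "0 < a" "b < T" "continuous_on UNIV \<phi>" "\<And>t. t \<notin> {a..b} \<Longrightarrow> \<phi> t = 0"
      by (rule test_funE[OF \<phi>]) blast
    obtain a' b' where ab': "0 < a'" "b' < T" "continuous_on UNIV \<psi>" "\<And>t. t \<notin> {a'..b'} \<Longrightarrow> \<psi> t = 0"
      by (rule test_funE[OF \<psi>]) blast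
    have "\<exists>\<Phi>\<in>test_fun T. deriv \<Phi> = (\<lambda>t. \<phi> t - d * \<psi> t)"
    proof (rule test_fun_primitive)
      show "continuous_on UNIV (\<lambda>t. \<phi> t - d * \<psi> t)"
        by (intro continuous_intros ab ab')
      show "0 < min a a'" "max b b' < T" using ab ab' by auto
      show "\<phi> t - d * \<psi> t = 0" if "t \<notin> {min a a'..max b b'}" for t
      proof -
        have "t \<notin> {a..b}" "t \<notin> {a'..b'}" using that by auto
        then show ?thesis using ab(4) ab'(4) by simp
      qed
      show "(LINT t|M_int T. \<phi> t - d * \<psi> t) = 0"
        using i I by (simp add: d_def I_def)
    qed
    then have "(LINT t|M_int T. u t * (\<phi> t - d * \<psi> t)) = 0" using z by metis
    moreover have "(LINT t|M_int T. u t * (\<phi> t - d * \<psi> t))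
      = (LINT t|M_int T. u t * \<phi> t) - d * (LINT t|M_int T. u t * \<psi> t)"
      using j by (simp add: right_diff_distrib mult.left_commute[of _ d])
    ultimately have "(LINT t|M_int T. u t * \<phi> t) - c * (LINT t|M_int T. \<phi> t) = 0"
      by (simp add: c_def d_def)
    then show "(LINT t|M_int T. (1 * u t + (-c) * 1) * \<phi> t) = 0"
      using i j by (simp add: algebra_simps)
  qed
  then have "ae_eq T u (\<lambda>_. c)" by (simp add: ae_eq_def)
  then show ?thesis ..
qed

lemma integrable_ae_eq_cont:
  assumes "u \<in> borel_measurable (M_int T)" "ae_eq T u U" "continuous_on {0..T} U"
  shows "integrable (M_int T) u"
proof (rule integrable_cong_AE_imp)
  show "integrable (M_int T) U"
    using integrable_mult_cont[OF finite_measure.integrable_const[OF finite_measure_M_int, of _ 1] assms(3)]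
    by simp
  show "AE t in M_int T. U t = u t" using assms(2) unfolding ae_eq_def by eventually_elim simp
qed fact

text \<open>Integration by parts: the product rule for \<open>U\<close> and a test function,
  integrated over (0,T), has no boundary terms because the test function vanishes at 0 and
  \<open>T\<close>.\<close>

lemma is_primitive_imp_weak_deriv:
  assumes T: "T > 0" and U: "is_primitive T U g"
    and u: "u \<in> borel_measurable (M_int T)" "ae_eq T u U"
  shows "is_weak_deriv T u g"
  unfolding is_weak_deriv_def
proof (intro conjI ballI)
  note g = is_primitive_integrable[OF U] and c = is_primitive_continuous[OF U]
  show "loc_integrable T u"
    using integrable_ae_eq_cont[OF u c] by (rule integrable_imp_loc_integrable)
  show "loc_integrable T g" using g by (rule integrable_imp_loc_integrable)
  fix \<phi> assume \<phi>: "\<phi> \<in> test_fun T"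
  then obtain a b where ab: "0 < a" "b < T" "\<And>t. (\<phi> has_real_derivative deriv \<phi> t) (at t)"
    "continuous_on UNIV \<phi>" "continuous_on UNIV (deriv \<phi>)" "\<And>t. t \<notin> {a..b} \<Longrightarrow> \<phi> t = 0"
    by (rule test_funE) blast
  have "is_primitive T \<phi> (deriv \<phi>)"
    by (rule is_primitive_C1) (auto intro: has_field_derivative_at_within ab continuous_on_subset[OF ab(5)])
  from is_primitive_integral_eq[OF is_primitive_mult[OF U this]]
  have "(LINT t|M_int T. g t * \<phi> t + U t * deriv \<phi> t) = 0"
    using T ab(1,2) ab(6)[of 0] ab(6)[of T] by simp
  moreover have "loc_integrable T U"
    by (rule integrable_imp_loc_integrable, rule integrable_ae_eq_cont[OF _ _ c])
       (auto simp: ae_eq_def continuous_on_measurable_M_int[OF c])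
  ultimately have "(LINT t|M_int T. U t * deriv \<phi> t) = - (LINT t|M_int T. g t * \<phi> t)"
    using integrable_times_test_fun[OF _ \<phi>] integrable_imp_loc_integrable[OF g] by simp
  moreover have "(LINT t|M_int T. u t * deriv \<phi> t) = (LINT t|M_int T. U t * deriv \<phi> t)"
  proof (rule integral_cong_AE)
    have "deriv \<phi> \<in> borel_measurable (M_int T)"
      by (rule continuous_on_measurable_M_int) (rule continuous_on_subset[OF ab(5)], simp)
    then show "(\<lambda>t. u t * deriv \<phi> t) \<in> borel_measurable (M_int T)"
      "(\<lambda>t. U t * deriv \<phi> t) \<in> borel_measurable (M_int T)"
      using u(1) continuous_on_measurable_M_int[OF c] by auto
    show "AE t in M_int T. u t * deriv \<phi> t = U t * deriv \<phi> t"
      using u(2) unfolding ae_eq_def by eventually_elim simp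
  qed
  ultimately show "(LINT t|M_int T. u t * deriv \<phi> t) = - (LINT t|M_int T. g t * \<phi> t)" by simp
qed

text \<open>\<open>prim T g\<close> also has weak derivative \<open>g\<close>, so its difference
  from \<open>u\<close> has weak derivative zero and is constant almost everywhere.\<close>

lemma weak_deriv_imp_primitive:
  assumes T: "T > 0" and ug: "is_weak_deriv T u g" and g: "integrable (M_int T) g"
  shows "\<exists>U. is_primitive T U g \<and> ae_eq T u U"
proof -
  let ?G = "prim T g"
  have G: "is_weak_deriv T ?G g"
    by (rule is_primitive_imp_weak_deriv[OF T])
      (use is_primitive_prim[OF T g, of 0] continuous_on_measurable_M_int[OF continuous_on_prim[OF g]]
        in \<open>auto simp: ae_eq_def\<close>)
  have l: "loc_integrable T u" "loc_integrable T ?G"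
    using ug G by (auto simp: is_weak_deriv_def)
  have "\<exists>c. ae_eq T (\<lambda>t. 1 * u t + (-1) * ?G t) (\<lambda>_. c)"
  proof (rule weak_deriv_zero_imp_const[OF T loc_integrable_lincomb[OF l]])
    fix \<phi> assume \<phi>: "\<phi> \<in> test_fun T"
    have "(LINT t|M_int T. u t * deriv \<phi> t) = (LINT t|M_int T. ?G t * deriv \<phi> t)"
      using ug G \<phi> by (simp add: is_weak_deriv_def)
    then show "(LINT t|M_int T. (1 * u t + (-1) * ?G t) * deriv \<phi> t) = 0"
      using l[THEN integrable_times_test_fun(2)[OF _ \<phi>]] by (simp add: algebra_simps)
  qed
  then obtain c where "ae_eq T (\<lambda>t. 1 * u t + (-1) * ?G t) (\<lambda>_. c)" ..
  then have "ae_eq T u (\<lambda>t. c + ?G t)" by (simp add: ae_eq_def algebra_simps)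
  then show ?thesis using is_primitive_prim[OF T g, of c] by blast
qed

text \<open>If the values at 0 differed, continuity would keep \<open>U\<close> and \<open>V\<close>
  apart on an interval (0,m), which has positive measure. This makes the trace at 0 well
  defined.\<close>

lemma continuous_ae_eq_at_zero:
  assumes T: "T > 0" and c: "continuous_on {0..T} U" "continuous_on {0..T} V" and ae: "ae_eq T U V"
  shows "U 0 = V 0"
proof (rule ccontr)
  assume "U 0 \<noteq> V 0"
  have "continuous_on {0..T} (\<lambda>t. U t - V t)" by (intro continuous_intros c)
  then have "\<exists>d>0. \<forall>t\<in>{0..T}. dist t 0 < d \<longrightarrow> dist (U t - V t) (U 0 - V 0) < \<bar>U 0 - V 0\<bar>"
    by (rule continuous_on_iff[THEN iffD1, rule_format]) (use T \<open>U 0 \<noteq> V 0\<close> in auto)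
  then obtain d where "d > 0" and d: "\<And>t. t \<in> {0..T} \<Longrightarrow> dist t 0 < d \<Longrightarrow> U t \<noteq> V t"
    by (force simp: dist_real_def)
  define m where "m = min d T"
  have "m > 0" using \<open>d > 0\<close> T by (simp add: m_def)
  have "AE t in lebesgue. t \<in> {0<..<T} \<longrightarrow> U t = V t"
    using ae by (simp add: ae_eq_def AE_M_int_iff)
  then have "AE t in lebesgue. t \<in> {0<..<m} \<longrightarrow> 1 = (0 :: real)"
    by eventually_elim (use d in \<open>auto simp: m_def dist_real_def\<close>)
  then have "ae_eq m (\<lambda>_. 1) (\<lambda>_. 0)"
    by (simp add: ae_eq_def AE_M_int_iff)
  then show False using not_ae_eq_one_zero[OF \<open>m > 0\<close>] by simp
qed

lemma trace0_eq:
  assumes T: "T > 0" and c: "continuous_on {0..T} U" and ae: "ae_eq T u U"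
  shows "trace0 T u = U 0"
  unfolding trace0_def
proof (rule the_equality)
  show "\<exists>v. continuous_on {0..T} v \<and> ae_eq T u v \<and> v 0 = U 0" using c ae by blast
  fix r assume "\<exists>v. continuous_on {0..T} v \<and> ae_eq T u v \<and> v 0 = r"
  then obtain v where v: "continuous_on {0..T} v" "ae_eq T u v" "v 0 = r" by blast
  have "ae_eq T v U" using v(2) ae unfolding ae_eq_def by eventually_elim simp
  then show "r = U 0" using continuous_ae_eq_at_zero[OF T v(1) c] v(3) by simp
qed

section \<open>Weak derivatives expressed through representatives\<close>

lemma weak_deriv_0 [simp]: "weak_deriv T 0 u = u"
  by (simp add: weak_deriv_def)

lemma weak_deriv_2: "weak_deriv T 2 u = weak_deriv T 1 (weak_deriv T 1 u)"
  by (simp add: weak_deriv_def numeral_2_eq_2)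

text \<open>The choice operator returns some weak derivative, known only up to null sets; this is
  why the estimates below are carried out on fixed representatives.\<close>

lemma weak_deriv_1_spec:
  assumes "is_weak_deriv T u g"
  shows "is_weak_deriv T u (weak_deriv T 1 u)" "ae_eq T (weak_deriv T 1 u) g"
    "weak_deriv T 1 u \<in> borel_measurable (M_int T)"
proof -
  show *: "is_weak_deriv T u (weak_deriv T 1 u)"
    using someI[of "is_weak_deriv T u", OF assms] by (simp add: weak_deriv_def)
  show "ae_eq T (weak_deriv T 1 u) g" by (rule is_weak_deriv_unique[OF * assms])
  show "weak_deriv T 1 u \<in> borel_measurable (M_int T)"
    using * by (simp add: is_weak_deriv_def loc_integrable_measurable)
qed

lemma L2_integrable:
  assumes "u \<in> L2 T"
  shows "integrable (M_int T) u"
  by (rule finite_measure.square_integrable_imp_integrable[OF finite_measure_M_int]) (use assms in \<open>auto simp: L2_def\<close>)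

lemma L2_ae_eq_cont:
  assumes "continuous_on {0..T} U" "u \<in> borel_measurable (M_int T)" "ae_eq T u U"
  shows "u \<in> L2 T"
proof -
  have "integrable (M_int T) (\<lambda>t. (u t)\<^sup>2)"
    by (rule integrable_ae_eq_cont[where U = "\<lambda>t. (U t)\<^sup>2"])
      (use assms in \<open>auto intro!: continuous_intros simp: ae_eq_def\<close>)
  then show ?thesis using assms by (simp add: L2_def)
qed

text \<open>\<open>U\<close> and \<open>P\<close> are the continuous representatives of
  \<open>u\<close> and of its derivative, and \<open>q\<close> is a second derivative. Since
  \<open>U\<close> and \<open>P\<close> are defined pointwise on the closed interval,
  \<open>U 0\<close> and \<open>P 0\<close> are the traces.\<close>

definition H2_rep :: "real \<Rightarrow> (real \<Rightarrow> real) \<Rightarrow> (real \<Rightarrow> real) \<Rightarrow> (real \<Rightarrow> real) \<Rightarrow> (real \<Rightarrow> real) \<Rightarrow> bool" where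
  "H2_rep T u U P q \<longleftrightarrow> u \<in> borel_measurable (M_int T) \<and> ae_eq T u U
     \<and> is_primitive T U P \<and> is_primitive T P q \<and> q \<in> L2 T"

text \<open>Apply \<open>weak_deriv_imp_primitive\<close> to each of the two derivatives, then
  replace the density of \<open>U\<close> by its own continuous representative.\<close>

lemma Hsp_2_rep:
  assumes T: "T > 0" and u: "u \<in> Hsp T 2"
  shows "\<exists>U P q. H2_rep T u U P q"
proof -
  obtain g q where u: "u \<in> L2 T" and g: "g \<in> L2 T" and q: "q \<in> L2 T"
    and w: "is_weak_deriv T u g" "is_weak_deriv T g q"
    using u by (auto simp: numeral_2_eq_2)
  obtain U where U: "is_primitive T U g" "ae_eq T u U"
    using weak_deriv_imp_primitive[OF T w(1) L2_integrable[OF g]] by blast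
  obtain P where P: "is_primitive T P q" "ae_eq T g P"
    using weak_deriv_imp_primitive[OF T w(2) L2_integrable[OF q]] by blast
  have "integrable (M_int T) P"
    using is_primitive_continuous[OF P(1)]
    by (intro integrable_ae_eq_cont) (auto simp: ae_eq_def continuous_on_measurable_M_int)
  then have "is_primitive T U P"
    by (rule is_primitive_cong[OF U(1) _ P(2)])
  then show ?thesis using u U P q by (auto simp: H2_rep_def L2_def)
qed

lemma H2_rep_weak_deriv:
  assumes T: "T > 0" and r: "H2_rep T u U P q"
  shows "is_weak_deriv T u P" "is_weak_deriv T P q"
    "weak_deriv T 1 u \<in> borel_measurable (M_int T)" "ae_eq T (weak_deriv T 1 u) P"
    "weak_deriv T 2 u \<in> borel_measurable (M_int T)" "ae_eq T (weak_deriv T 2 u) q"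
    "trace0 T u = U 0" "trace0 T (weak_deriv T 1 u) = P 0"
proof -
  have r: "u \<in> borel_measurable (M_int T)" "ae_eq T u U" "is_primitive T U P" "is_primitive T P q"
    using r by (auto simp: H2_rep_def)
  note cP = is_primitive_continuous[OF r(4)] and cU = is_primitive_continuous[OF r(3)]
  show w: "is_weak_deriv T u P" by (rule is_primitive_imp_weak_deriv[OF T r(3,1,2)])
  show "is_weak_deriv T P q"
    by (rule is_primitive_imp_weak_deriv[OF T r(4)])
       (auto simp: ae_eq_def continuous_on_measurable_M_int[OF cP])
  show m: "weak_deriv T 1 u \<in> borel_measurable (M_int T)" and ae: "ae_eq T (weak_deriv T 1 u) P"
    by (rule weak_deriv_1_spec[OF w])+
  have "is_weak_deriv T (weak_deriv T 1 u) q"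
    by (rule is_primitive_imp_weak_deriv[OF T r(4) m ae])
  from weak_deriv_1_spec[OF this] show "weak_deriv T 2 u \<in> borel_measurable (M_int T)"
    "ae_eq T (weak_deriv T 2 u) q"
    unfolding weak_deriv_2 by auto
  show "trace0 T u = U 0" by (rule trace0_eq[OF T cU r(2)])
  show "trace0 T (weak_deriv T 1 u) = P 0" by (rule trace0_eq[OF T cP ae])
qed

lemma H2_rep_H20:
  assumes T: "T > 0" and r: "H2_rep T u U P q" and z: "U 0 = 0"
  shows "u \<in> H20 T"
proof -
  have r': "u \<in> borel_measurable (M_int T)" "ae_eq T u U" "is_primitive T U P" "is_primitive T P q" "q \<in> L2 T"
    using r by (auto simp: H2_rep_def)
  note cP = is_primitive_continuous[OF r'(4)] and cU = is_primitive_continuous[OF r'(3)]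
  have "u \<in> L2 T" by (rule L2_ae_eq_cont[OF cU r'(1,2)])
  moreover have "P \<in> L2 T"
    by (rule L2_ae_eq_cont[OF cP]) (auto simp: ae_eq_def continuous_on_measurable_M_int[OF cP])
  ultimately have "u \<in> Hsp T 2"
    using H2_rep_weak_deriv(1,2)[OF T r] r'(5) by (auto simp: numeral_2_eq_2)
  then show ?thesis using H2_rep_weak_deriv(7)[OF T r] z by (simp add: H20_def)
qed

lemma H20_rep:
  assumes T: "T > 0" and u: "u \<in> H20 T"
  obtains U P q where "H2_rep T u U P q" "U 0 = 0"
proof -
  have "u \<in> Hsp T 2" using u by (simp add: H20_def)
  from Hsp_2_rep[OF T this] obtain U P q where "H2_rep T u U P q" by blast
  then show thesis using that H2_rep_weak_deriv(7)[OF T] u by (auto simp: H20_def)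
qed

lemma L2_lincomb:
  assumes "u \<in> L2 T" "v \<in> L2 T"
  shows "(\<lambda>t. a * u t + b * v t) \<in> L2 T"
proof -
  have [measurable]: "u \<in> borel_measurable (M_int T)" "v \<in> borel_measurable (M_int T)"
    and i: "integrable (M_int T) (\<lambda>t. (u t)\<^sup>2)" "integrable (M_int T) (\<lambda>t. (v t)\<^sup>2)"
    using assms by (auto simp: L2_def)
  have "integrable (M_int T) (\<lambda>t. (a * u t + b * v t)\<^sup>2)"
  proof (rule Bochner_Integration.integrable_bound)
    show "integrable (M_int T) (\<lambda>t. 2 * a\<^sup>2 * (u t)\<^sup>2 + 2 * b\<^sup>2 * (v t)\<^sup>2)" using i by simp
    have "(a * u t + b * v t)\<^sup>2 \<le> 2 * a\<^sup>2 * (u t)\<^sup>2 + 2 * b\<^sup>2 * (v t)\<^sup>2" for t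
      using zero_le_power2[of "a * u t - b * v t"] by (simp add: power2_eq_square algebra_simps)
    then show "AE t in M_int T. norm ((a * u t + b * v t)\<^sup>2) \<le> norm (2 * a\<^sup>2 * (u t)\<^sup>2 + 2 * b\<^sup>2 * (v t)\<^sup>2)"
      by (intro AE_I2) (simp add: order_trans[OF _ abs_ge_self])
  qed measurable
  then show ?thesis by (simp add: L2_def)
qed

lemma H2_rep_lincomb:
  assumes r: "H2_rep T u U P q" "H2_rep T v V R s"
    and z: "z \<in> borel_measurable (M_int T)" "ae_eq T z (\<lambda>t. a * u t + b * v t)"
  shows "H2_rep T z (\<lambda>t. a * U t + b * V t) (\<lambda>t. a * P t + b * R t) (\<lambda>t. a * q t + b * s t)"
proof -
  have "ae_eq T u U" "ae_eq T v V" using r by (auto simp: H2_rep_def)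
  with z(2) have "ae_eq T z (\<lambda>t. a * U t + b * V t)"
    unfolding ae_eq_def by eventually_elim simp
  then show ?thesis using r z(1) unfolding H2_rep_def
    by (blast intro: is_primitive_lincomb L2_lincomb)
qed

section \<open>Energy estimates\<close>

lemma L2_measurable: "u \<in> L2 T \<Longrightarrow> u \<in> borel_measurable (M_int T)"
  by (simp add: L2_def)

lemma L2_norm_nonneg [simp]: "0 \<le> L2_norm T u"
  by (simp add: L2_norm_def L2_inner_def)

lemma L2_norm_power2: "(L2_norm T u)\<^sup>2 = (LINT t|M_int T. (u t)\<^sup>2)"
  by (simp add: L2_norm_def L2_inner_def power2_eq_square)

lemma L2_inner_self: "L2_inner T u u = (L2_norm T u)\<^sup>2"
  by (simp add: L2_norm_def L2_inner_def)

lemma L2_inner_cong: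
  assumes "u \<in> borel_measurable (M_int T)" "u' \<in> borel_measurable (M_int T)" "ae_eq T u u'"
    and "v \<in> borel_measurable (M_int T)" "v' \<in> borel_measurable (M_int T)" "ae_eq T v v'"
  shows "L2_inner T u v = L2_inner T u' v'"
  unfolding L2_inner_def
proof (rule integral_cong_AE)
  show "AE t in M_int T. u t * v t = u' t * v' t"
    using assms(3,6) unfolding ae_eq_def by eventually_elim simp
qed (use assms in auto)

lemma L2_norm_cong:
  assumes "u \<in> borel_measurable (M_int T)" "u' \<in> borel_measurable (M_int T)" "ae_eq T u u'"
  shows "L2_norm T u = L2_norm T u'"
  unfolding L2_norm_def by (simp add: L2_inner_cong[OF assms assms])

lemma L2_mult_integrable:
  assumes "u \<in> L2 T" "v \<in> L2 T"
  shows "integrable (M_int T) (\<lambda>t. u t * v t)"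
proof (rule Bochner_Integration.integrable_bound)
  show "integrable (M_int T) (\<lambda>t. (u t)\<^sup>2 + (v t)\<^sup>2)" using assms by (auto simp: L2_def)
  show "(\<lambda>t. u t * v t) \<in> borel_measurable (M_int T)" using assms by (auto simp: L2_def)
  have "\<bar>u t * v t\<bar> \<le> (u t)\<^sup>2 + (v t)\<^sup>2" for t
  proof -
    have "2 * (\<bar>u t\<bar> * \<bar>v t\<bar>) \<le> (u t)\<^sup>2 + (v t)\<^sup>2"
      using sum_squares_bound[of "\<bar>u t\<bar>" "\<bar>v t\<bar>"] by simp
    then show ?thesis unfolding abs_mult by (smt (verit) mult_nonneg_nonneg abs_ge_zero)
  qed
  then show "AE t in M_int T. norm (u t * v t) \<le> norm ((u t)\<^sup>2 + (v t)\<^sup>2)"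
    by (intro AE_I2) (simp add: order_trans[OF _ abs_ge_self])
qed

lemma L2_inner_lincomb_left:
  assumes "u \<in> L2 T" "v \<in> L2 T" "w \<in> L2 T"
  shows "L2_inner T (\<lambda>t. a * u t + b * v t) w = a * L2_inner T u w + b * L2_inner T v w"
  using L2_mult_integrable[OF assms(1,3)] L2_mult_integrable[OF assms(2,3)]
  by (simp add: L2_inner_def distrib_right mult.assoc)

lemma L2_inner_commute: "L2_inner T u v = L2_inner T v u"
  by (simp add: L2_inner_def mult.commute)

lemma L2_norm_lincomb_power2:
  assumes "u \<in> L2 T" "v \<in> L2 T"
  shows "(L2_norm T (\<lambda>t. a * u t + b * v t))\<^sup>2
    = a\<^sup>2 * (L2_norm T u)\<^sup>2 + 2 * a * b * L2_inner T u v + b\<^sup>2 * (L2_norm T v)\<^sup>2"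
proof -
  note uv = L2_lincomb[OF assms]
  show ?thesis
    unfolding L2_inner_self[symmetric] L2_inner_lincomb_left[OF assms uv]
      L2_inner_commute[of T u "\<lambda>t. a * u t + b * v t"] L2_inner_commute[of T v "\<lambda>t. a * u t + b * v t"]
      L2_inner_lincomb_left[OF assms assms(1)] L2_inner_lincomb_left[OF assms assms(2)]
      L2_inner_commute[of T v u]
    by (simp add: power2_eq_square algebra_simps)
qed

lemma L2_Cauchy_Schwarz:
  assumes "u \<in> L2 T" "v \<in> L2 T"
  shows "\<bar>L2_inner T u v\<bar> \<le> L2_norm T u * L2_norm T v"
proof (cases "L2_norm T v = 0")
  case True
  have *: "0 \<le> (L2_norm T u)\<^sup>2 + 2 * b * L2_inner T u v" for b
    using L2_norm_lincomb_power2[OF assms, of 1 b] True zero_le_power2[of "L2_norm T (\<lambda>t. 1 * u t + b * v t)"] by simp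
  have "L2_inner T u v = 0"
  proof (rule ccontr)
    assume n: "L2_inner T u v \<noteq> 0"
    \<comment> \<open>This value of b turns the affine expression in \<open>*\<close> into
      -1.\<close>
    show False using *[of "- ((L2_norm T u)\<^sup>2 + 1) / (2 * L2_inner T u v)"] n
      by (simp add: field_simps)
  qed
  then show ?thesis using True by simp
next
  case False
  define A B C where "A = (L2_norm T u)\<^sup>2" and "B = L2_inner T u v" and "C = (L2_norm T v)\<^sup>2"
  \<comment> \<open>The squared norm of C u - B v, which equals C (C A - B^2).\<close>
  have "0 \<le> C\<^sup>2 * A + 2 * C * (- B) * B + (- B)\<^sup>2 * C"
    using L2_norm_lincomb_power2[OF assms, of C "- B"]
      zero_le_power2[of "L2_norm T (\<lambda>t. C * u t + (- B) * v t)"] unfolding A_def B_def C_def by simp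
  then have "0 \<le> C * (C * A - B\<^sup>2)" by (simp add: power2_eq_square algebra_simps)
  moreover have "C > 0" using False by (simp add: C_def)
  ultimately have "B\<^sup>2 \<le> (L2_norm T u * L2_norm T v)\<^sup>2"
    by (simp add: zero_le_mult_iff A_def C_def power_mult_distrib mult.commute)
  then show ?thesis unfolding B_def by (rule abs_le_square_iff[THEN iffD2, THEN order_trans]) simp
qed

lemma L2_norm_lincomb:
  assumes "u \<in> L2 T" "v \<in> L2 T"
  shows "L2_norm T (\<lambda>t. a * u t + b * v t) \<le> \<bar>a\<bar> * L2_norm T u + \<bar>b\<bar> * L2_norm T v"
proof (rule power2_le_imp_le)
  have "2 * a * b * L2_inner T u v \<le> 2 * \<bar>a * b\<bar> * \<bar>L2_inner T u v\<bar>"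
    using abs_ge_self[of "2 * a * b * L2_inner T u v"] by (simp add: abs_mult mult.assoc)
  also have "\<dots> \<le> 2 * \<bar>a * b\<bar> * (L2_norm T u * L2_norm T v)"
    by (intro mult_left_mono L2_Cauchy_Schwarz assms) simp
  finally show "(L2_norm T (\<lambda>t. a * u t + b * v t))\<^sup>2 \<le> (\<bar>a\<bar> * L2_norm T u + \<bar>b\<bar> * L2_norm T v)\<^sup>2"
    unfolding L2_norm_lincomb_power2[OF assms]
    by (simp add: power2_sum power_mult_distrib abs_mult mult_ac)
qed simp

lemma L2_mult_cont:
  assumes "continuous_on {0..T} V" "u \<in> L2 T"
  shows "(\<lambda>t. V t * u t) \<in> L2 T"
proof -
  have "integrable (M_int T) (\<lambda>t. (V t)\<^sup>2 * (u t)\<^sup>2)"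
    using assms by (intro integrable_mult_cont continuous_intros) (auto simp: L2_def)
  then show ?thesis
    using assms continuous_on_measurable_M_int[of T V] by (auto simp: L2_def power_mult_distrib)
qed

lemma continuous_on_L2:
  assumes "continuous_on {0..T} U"
  shows "U \<in> L2 T"
  by (rule L2_ae_eq_cont[OF assms continuous_on_measurable_M_int[OF assms]]) (simp add: ae_eq_def)

lemma L2_norm_mono:
  assumes "u \<in> L2 T" "v \<in> L2 T" "\<And>t. t \<in> {0<..<T} \<Longrightarrow> \<bar>u t\<bar> \<le> \<bar>v t\<bar>"
  shows "L2_norm T u \<le> L2_norm T v"
proof (rule power2_le_imp_le)
  show "(L2_norm T u)\<^sup>2 \<le> (L2_norm T v)\<^sup>2"
    unfolding L2_norm_power2
    by (rule integral_mono) (use assms in \<open>auto simp: L2_def abs_le_square_iff\<close>)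
qed simp

lemma L2_norm_const: "T > 0 \<Longrightarrow> L2_norm T (\<lambda>_. c) = sqrt T * \<bar>c\<bar>"
  by (simp add: L2_norm_def L2_inner_def measure_restrict_space real_sqrt_mult)

text \<open>Cauchy-Schwarz against the constant 1 bounds the primitive pointwise by
  \<open>sqrt T\<close> times the norm of \<open>g\<close>; taking the norm over (0,T) costs a
  second factor \<open>sqrt T\<close>.\<close>

lemma L2_norm_prim:
  assumes T: "T > 0" and g: "g \<in> L2 T"
  shows "L2_norm T (prim T g) \<le> T * L2_norm T g"
proof -
  have b: "\<bar>prim T g t\<bar> \<le> sqrt T * L2_norm T g" for t
  proof -
    have 1: "(\<lambda>_. 1) \<in> L2 T" by (rule continuous_on_L2) simp
    have a: "(\<lambda>t. \<bar>g t\<bar>) \<in> L2 T" using g by (auto simp: L2_def)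
    have "\<bar>prim T g t\<bar> \<le> (LINT s|M_int T. \<bar>indicator {..t} s * g s\<bar>)"
      unfolding prim_def by (rule integral_abs_bound)
    also have "\<dots> \<le> (LINT s|M_int T. \<bar>g s\<bar>)"
      by (rule integral_mono)
        (use integrable_M_int_cut[OF L2_integrable[OF g]] L2_integrable[OF g] in \<open>auto simp: indicator_def\<close>)
    also have "\<dots> = L2_inner T (\<lambda>_. 1) (\<lambda>t. \<bar>g t\<bar>)" by (simp add: L2_inner_def)
    also have "\<dots> \<le> L2_norm T (\<lambda>_. 1) * L2_norm T (\<lambda>t. \<bar>g t\<bar>)"
      using L2_Cauchy_Schwarz[OF 1 a] by simp
    also have "\<dots> = sqrt T * L2_norm T g"
      unfolding L2_norm_const[OF T] by (simp add: L2_norm_def L2_inner_def flip: abs_mult)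
    finally show ?thesis .
  qed
  have "L2_norm T (prim T g) \<le> L2_norm T (\<lambda>_. sqrt T * L2_norm T g)"
    by (rule L2_norm_mono) (use b T in \<open>auto intro!: continuous_on_L2 continuous_on_prim L2_integrable g simp: abs_mult\<close>)
  also have "\<dots> = T * L2_norm T g" using T by (simp add: L2_norm_const abs_mult)
  finally show ?thesis .
qed

lemma L2_norm_primitive_zero:
  assumes T: "T > 0" and U: "is_primitive T U g" "U 0 = 0" and g: "g \<in> L2 T"
  shows "L2_norm T U \<le> T * L2_norm T g"
proof -
  have "L2_norm T U = L2_norm T (prim T g)"
    unfolding L2_norm_def L2_inner_def
    by (rule arg_cong[where f = sqrt], rule Bochner_Integration.integral_cong)
       (use is_primitiveD[OF U(1)] U(2) in auto)
  then show ?thesis using L2_norm_prim[OF T g] by simp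
qed

text \<open>The constant \<open>P 0\<close> equals \<open>P\<close> minus the primitive of
  \<open>q\<close>. Its norm is \<open>sqrt T\<close> times its modulus, and the triangle inequality
  bounds it by the two parts of the \<open>H20_norm\<close>.\<close>

lemma initial_value_bound:
  assumes T: "T > 0" and P: "is_primitive T P q" and q: "q \<in> L2 T"
  shows "\<bar>P 0\<bar> \<le> sqrt T * (L2_norm T q + 1 / T * L2_norm T P)"
proof -
  have cP: "P \<in> L2 T" by (intro continuous_on_L2 is_primitive_continuous[OF P])
  have cq: "prim T q \<in> L2 T" by (intro continuous_on_L2 continuous_on_prim L2_integrable q)
  have "sqrt T * \<bar>P 0\<bar> = L2_norm T (\<lambda>_. P 0)" by (simp add: L2_norm_const[OF T])
  also have "\<dots> = L2_norm T (\<lambda>t. 1 * P t + (-1) * prim T q t)"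
    unfolding L2_norm_def L2_inner_def
  proof (rule arg_cong[where f = sqrt], rule Bochner_Integration.integral_cong[OF refl])
    fix t assume "t \<in> space (M_int T)"
    then have "t \<in> {0..T}" by simp
    from is_primitiveD[OF P this] have "P 0 = 1 * P t + (-1) * prim T q t" by simp
    then show "P 0 * P 0 = (1 * P t + (-1) * prim T q t) * (1 * P t + (-1) * prim T q t)" by metis
  qed
  also have "\<dots> \<le> L2_norm T P + L2_norm T (prim T q)"
    using L2_norm_lincomb[OF cP cq, of 1 "-1"] by simp
  also have "\<dots> \<le> L2_norm T P + T * L2_norm T q" using L2_norm_prim[OF T q] by simp
  also have "\<dots> = sqrt T * (sqrt T * (L2_norm T q + 1 / T * L2_norm T P))"
    using T by (simp add: mult.assoc[symmetric]) (simp add: field_simps)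
  finally show ?thesis using T by simp
qed

section \<open>Coercivity and boundedness of the form under the exponential weight\<close>

lemma H2_rep_L2:
  assumes "H2_rep T u U P q"
  shows "U \<in> L2 T" "P \<in> L2 T" "q \<in> L2 T"
  using assms unfolding H2_rep_def by (auto intro: continuous_on_L2 is_primitive_continuous)

lemma a_form_rep:
  assumes T: "T > 0" and u: "H2_rep T u U P q" and w: "H2_rep T w W R s"
  shows "a_form T \<mu> u w = L2_inner T q R + P 0 * R 0 + \<mu> * L2_inner T U R"
proof -
  note L = H2_rep_L2[OF u, THEN L2_measurable] H2_rep_L2[OF w, THEN L2_measurable]
  note du = H2_rep_weak_deriv[OF T u] and dw = H2_rep_weak_deriv[OF T w]
  have u': "u \<in> borel_measurable (M_int T)" "ae_eq T u U" using u by (auto simp: H2_rep_def)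
  show ?thesis
    unfolding a_form_def du(8) dw(8) L2_inner_cong[OF du(5) L(3) du(6) dw(3) L(5) dw(4)]
       L2_inner_cong[OF u'(1) L(1) u'(2) dw(3) L(5) dw(4)] ..
qed

lemma L2_norm_weak_deriv_rep:
  assumes T: "T > 0" and u: "H2_rep T u U P q"
  shows "L2_norm T (weak_deriv T 1 u) = L2_norm T P" "L2_norm T (weak_deriv T 2 u) = L2_norm T q"
  using L2_norm_cong H2_rep_weak_deriv[OF T u] H2_rep_L2[OF u, THEN L2_measurable] by blast+

lemma H20_norm_rep:
  assumes T: "T > 0" and u: "H2_rep T u U P q"
  shows "H20_norm T u = L2_norm T q + 1 / T * L2_norm T P"
  by (simp only: H20_norm_def L2_norm_weak_deriv_rep[OF assms])

text \<open>The derivative of \<open>L_op T w\<close> is the weighted derivative exp (-t/T) P, whose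
  own derivative comes from the product rule. The representative starts at 0, so the operator maps
  into \<open>H20 T\<close>.\<close>

lemma L_op_rep:
  assumes T: "T > 0" and w: "H2_rep T w W P q"
  shows "H2_rep T (L_op T w) (\<lambda>t. 0 + prim T (\<lambda>s. exp (- s / T) * P s) t) (\<lambda>t. exp (- t / T) * P t)
    (\<lambda>t. (- 1 / T) * exp (- t / T) * P t + exp (- t / T) * q t)"
proof -
  let ?E = "\<lambda>t. exp (- t / T)"
  have w': "is_primitive T W P" "is_primitive T P q" "q \<in> L2 T"
    using w by (auto simp: H2_rep_def)
  have cE: "continuous_on {0..T} ?E" by (intro continuous_intros) (use T in auto)
  note cP = is_primitive_continuous[OF w'(2)]
  note d = H2_rep_weak_deriv(3,4)[OF T w]
  have i: "integrable (M_int T) (\<lambda>s. ?E s * P s)"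
    by (intro integrable_mult_cont cE L2_integrable H2_rep_L2[OF w])
  have ae: "ae_eq T (\<lambda>s. ?E s * weak_deriv T 1 w s) (\<lambda>s. ?E s * P s)"
    using d(2) unfolding ae_eq_def by eventually_elim simp
  have j: "integrable (M_int T) (\<lambda>s. ?E s * weak_deriv T 1 w s)"
    by (rule integrable_ae_eq_cont[OF _ ae])
      (use continuous_on_measurable_M_int[OF cE] d(1) cE cP in \<open>auto intro!: continuous_intros\<close>)
  have L: "L_op T w t = prim T (\<lambda>s. ?E s * P s) t" if "t \<in> {0<..<T}" for t
  proof -
    from that have t: "t \<in> {0..T}" by simp
    have "integrable (lebesgue_on {0..t}) (\<lambda>s. ?E s * weak_deriv T 1 w s)"
      using prim_eq_integral(1)[OF j t] by (simp add: set_integrable_def integrable_restrict_space)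
    then have "L_op T w t = integral {0..t} (\<lambda>s. ?E s * weak_deriv T 1 w s)"
      unfolding L_op_def by (rule lebesgue_integral_eq_integral) simp
    also have "\<dots> = prim T (\<lambda>s. ?E s * P s) t"
      using prim_eq_integral(2)[OF j t] prim_cong_AE[OF j i ae] by simp
    finally show ?thesis .
  qed
  have "prim T (\<lambda>s. ?E s * P s) \<in> borel_measurable (M_int T)"
    by (intro continuous_on_measurable_M_int continuous_on_prim i)
  then have m: "L_op T w \<in> borel_measurable (M_int T)"
    by (rule measurable_cong[THEN iffD2, rotated]) (use L in auto)
  have E: "is_primitive T ?E (\<lambda>t. - 1 / T * ?E t)"
    by (rule is_primitive_C1) (use T in \<open>auto intro!: derivative_eq_intros continuous_intros\<close>)
  have "(\<lambda>t. - 1 / T * ?E t * P t) \<in> L2 T"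
    by (intro continuous_on_L2 continuous_intros cE cP) (use T in auto)
  then have "(\<lambda>t. 1 * (- 1 / T * ?E t * P t) + 1 * (?E t * q t)) \<in> L2 T"
    by (rule L2_lincomb[OF _ L2_mult_cont[OF cE w'(3)]])
  then show ?thesis
    unfolding H2_rep_def
    using m L is_primitive_prim[OF T i, of 0] is_primitive_mult[OF E w'(2)]
    by (auto simp: ae_eq_def)
qed

text \<open>Integrate the derivative of P^2 exp (-t/T) over (0,T). The decay of the weight produces
  the positive term with factor 1/T, and the weight is 1 at 0 and exp (-1) at
  \<open>T\<close>.\<close>

lemma weighted_integral_identity:
  assumes T: "T > 0" and P: "is_primitive T P q"
  shows "2 * (LINT t|M_int T. q t * (exp (- t / T) * P t))
    = (P T)\<^sup>2 * exp (- 1) - (P 0)\<^sup>2 + 1 / T * (LINT t|M_int T. exp (- t / T) * (P t)\<^sup>2)"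
proof -
  let ?E = "\<lambda>t. exp (- t / T)"
  have cE: "continuous_on {0..T} ?E" by (intro continuous_intros) (use T in auto)
  note cP = is_primitive_continuous[OF P]
  have E: "is_primitive T ?E (\<lambda>t. - 1 / T * ?E t)"
    by (rule is_primitive_C1) (use T in \<open>auto intro!: derivative_eq_intros continuous_intros\<close>)
  have i: "integrable (M_int T) (\<lambda>t. (?E t * P t) * q t)"
    by (intro integrable_mult_cont is_primitive_integrable[OF P] continuous_intros cE cP)
  have j: "integrable (M_int T) (\<lambda>t. ?E t * (P t)\<^sup>2)"
    by (intro L2_integrable continuous_on_L2 continuous_intros cE cP)
  have "(LINT t|M_int T. (q t * P t + P t * q t) * ?E t + P t * P t * (- 1 / T * ?E t))
     = P T * P T * ?E T - P 0 * P 0 * ?E 0"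
    using is_primitive_integral_eq[OF is_primitive_mult[OF is_primitive_mult[OF P P] E]] T by simp
  also have "(\<lambda>t. (q t * P t + P t * q t) * ?E t + P t * P t * (- 1 / T * ?E t))
     = (\<lambda>t. 2 * ((?E t * P t) * q t) - 1 / T * (?E t * (P t)\<^sup>2))"
    by (simp add: fun_eq_iff power2_eq_square algebra_simps)
  also have "(LINT t|M_int T. 2 * ((?E t * P t) * q t) - 1 / T * (?E t * (P t)\<^sup>2))
     = 2 * (LINT t|M_int T. (?E t * P t) * q t) - 1 / T * (LINT t|M_int T. ?E t * (P t)\<^sup>2)"
    using i j by (simp del: times_divide_eq_left)
  finally show ?thesis using T by (simp add: power2_eq_square mult_ac)
qed

text \<open>The weighted identity for \<open>P\<close>, with the weight bounded below by exp (-1),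
  leaves the deficit (P 0)^2 / 2; the trace term of the form adds (P 0)^2 and turns it into a gain.
  The identity for \<open>W\<close>, which starts at 0, shows that the \<mu>-term is
  nonnegative.\<close>

lemma a_form_coercive:
  assumes T: "T > 0" and \<mu>: "\<mu> \<ge> 0" and w: "H2_rep T w W P q" and W0: "W 0 = 0"
  shows "1 / (2 * T * exp 1) * (L2_norm T P)\<^sup>2 + (P 0)\<^sup>2 / 2 \<le> a_form T \<mu> w (L_op T w)"
proof -
  let ?E = "\<lambda>t. exp (- t / T)"
  have w': "is_primitive T W P" "is_primitive T P q"
    using w by (auto simp: H2_rep_def)
  have cE: "continuous_on {0..T} ?E" by (intro continuous_intros) (use T in auto)
  note cP = is_primitive_continuous[OF w'(2)]
  have j: "integrable (M_int T) (\<lambda>t. ?E t * (P t)\<^sup>2)" "integrable (M_int T) (\<lambda>t. (P t)\<^sup>2)"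
    by (intro L2_integrable continuous_on_L2 continuous_intros cE cP)+
  have "exp (- 1) * (L2_norm T P)\<^sup>2 = (LINT t|M_int T. exp (- 1) * (P t)\<^sup>2)"
    by (simp add: L2_norm_power2)
  also have "\<dots> \<le> (LINT t|M_int T. ?E t * (P t)\<^sup>2)"
    by (rule integral_mono) (use j T in \<open>auto intro!: mult_right_mono simp: field_simps\<close>)
  finally have "1 / T * (exp (- 1) * (L2_norm T P)\<^sup>2) \<le> 1 / T * (LINT t|M_int T. ?E t * (P t)\<^sup>2)"
    using T by (intro mult_left_mono) auto
  moreover have "0 \<le> (P T)\<^sup>2 * exp (- 1 :: real)" by simp
  ultimately have 1: "1 / T * (exp (- 1) * (L2_norm T P)\<^sup>2) - (P 0)\<^sup>2 \<le> 2 * L2_inner T q (\<lambda>t. ?E t * P t)"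
    using weighted_integral_identity[OF T w'(2)] unfolding L2_inner_def by linarith
  have "0 \<le> 1 / T * (LINT t|M_int T. ?E t * (W t)\<^sup>2)"
    using T by (intro mult_nonneg_nonneg integral_nonneg) auto
  moreover have "0 \<le> (W T)\<^sup>2 * exp (- 1 :: real)" by simp
  ultimately have "0 \<le> 2 * (LINT t|M_int T. P t * (?E t * W t))"
    using weighted_integral_identity[OF T w'(1)] W0 by simp
  then have 2: "0 \<le> \<mu> * L2_inner T W (\<lambda>t. ?E t * P t)"
    using \<mu> by (simp add: L2_inner_def mult_ac)
  have "1 / T * (exp (- 1) * (L2_norm T P)\<^sup>2) = 2 * (1 / (2 * T * exp 1) * (L2_norm T P)\<^sup>2)"
    using T by (simp add: exp_minus field_simps)
  with 1 2 show ?thesis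
    unfolding a_form_rep[OF T w L_op_rep[OF T w]] by (simp add: power2_eq_square)
qed

lemma H2_norm_bounds:
  assumes T: "T > 0" and e: "H2_rep T e U V r" and U0: "U 0 = 0"
  shows "L2_norm T r \<le> H20_norm T e" "L2_norm T V \<le> T * H20_norm T e"
    "L2_norm T U \<le> T\<^sup>2 * H20_norm T e" "\<bar>V 0\<bar> \<le> sqrt T * H20_norm T e"
proof -
  note N = H20_norm_rep[OF T e]
  have e': "is_primitive T U V" "is_primitive T V r" "r \<in> L2 T" "V \<in> L2 T"
    using e H2_rep_L2[OF e] by (auto simp: H2_rep_def)
  show "L2_norm T r \<le> H20_norm T e" using T unfolding N by simp
  show 1: "L2_norm T V \<le> T * H20_norm T e"
    unfolding N using T by (simp add: distrib_left)
  have "L2_norm T U \<le> T * L2_norm T V" by (rule L2_norm_primitive_zero[OF T e'(1) U0 e'(4)])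
  also have "\<dots> \<le> T * (T * H20_norm T e)" using 1 T by (intro mult_left_mono) auto
  finally show "L2_norm T U \<le> T\<^sup>2 * H20_norm T e" by (simp add: power2_eq_square mult.assoc)
  show "\<bar>V 0\<bar> \<le> sqrt T * H20_norm T e"
    unfolding N by (rule initial_value_bound[OF T e'(2,3)])
qed

text \<open>Cauchy-Schwarz with the weight at most 1. The initial value \<open>P 0\<close> stays
  separate: it is to be absorbed by the trace term in \<open>a_form_coercive\<close>, not bounded by
  the norm of \<open>P\<close>.\<close>

lemma a_form_bounded:
  assumes T: "T > 0" and \<mu>: "\<mu> \<ge> 0" and e: "H2_rep T e U V r" and U0: "U 0 = 0"
    and w: "H2_rep T w W P q"
  shows "a_form T \<mu> e (L_op T w)
    \<le> (1 + \<mu> * T\<^sup>2) * H20_norm T e * L2_norm T P + sqrt T * H20_norm T e * \<bar>P 0\<bar>"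
proof -
  let ?N = "H20_norm T e" and ?EP = "\<lambda>t. exp (- t / T) * P t"
  note b = H2_norm_bounds[OF T e U0]
  have EP: "?EP \<in> L2 T"
    by (intro L2_mult_cont H2_rep_L2[OF w] continuous_intros) (use T in auto)
  have nEP: "L2_norm T ?EP \<le> L2_norm T P"
    by (rule L2_norm_mono[OF EP H2_rep_L2(2)[OF w]])
      (use T in \<open>auto simp: abs_mult intro!: mult_left_le_one_le\<close>)
  have N0: "0 \<le> ?N" using b(1) L2_norm_nonneg[of T r] by linarith
  have c: "L2_inner T v ?EP \<le> K * L2_norm T P" if "v \<in> L2 T" "L2_norm T v \<le> K" for v K
  proof -
    have "L2_inner T v ?EP \<le> L2_norm T v * L2_norm T ?EP"
      using L2_Cauchy_Schwarz[OF that(1) EP] by simp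
    also have "\<dots> \<le> K * L2_norm T P"
      by (rule mult_mono) (use that(2) nEP order_trans[OF L2_norm_nonneg that(2)] in auto)
    finally show ?thesis .
  qed
  have "L2_inner T r ?EP \<le> ?N * L2_norm T P" using c[OF H2_rep_L2(3)[OF e] b(1)] .
  moreover have "\<mu> * L2_inner T U ?EP \<le> \<mu> * (T\<^sup>2 * ?N * L2_norm T P)"
    using \<mu> c[OF H2_rep_L2(1)[OF e] b(3)] by (intro mult_left_mono)
  moreover have "V 0 * P 0 \<le> (sqrt T * ?N) * \<bar>P 0\<bar>"
    using mult_right_mono[OF b(4), of "\<bar>P 0\<bar>"] abs_ge_self[of "V 0 * P 0"] by (simp add: abs_mult)
  ultimately show ?thesis
    unfolding a_form_rep[OF T e L_op_rep[OF T w]] by (simp add: algebra_simps)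
qed

text \<open>Here 2 T e is the reciprocal of the coercivity constant, 1 + \<mu> T^2 comes from
  boundedness, the extra T from Young's inequality for the initial values, and the final 1 makes the
  constant at least 1.\<close>

definition stability_const :: "real \<Rightarrow> real \<Rightarrow> real" where
  "stability_const T \<mu> = (1 + \<mu> * T\<^sup>2 + T) * (2 * T * exp 1) + 1"

text \<open>Coercivity and boundedness give a quadratic inequality for the norm X of
  \<open>P\<close> in terms of the norm N of \<open>e\<close>. If the bound failed, then also N < X,
  and the right-hand side would be too small.\<close>

lemma stability_estimate:
  assumes T: "T > 0" and \<mu>: "\<mu> \<ge> 0" and e: "H2_rep T e U V r" "U 0 = 0"
    and w: "H2_rep T w W P q" "W 0 = 0"
    and eq: "a_form T \<mu> w (L_op T w) = a_form T \<mu> e (L_op T w)"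
  shows "L2_norm T P \<le> stability_const T \<mu> * H20_norm T e"
proof (rule ccontr)
  define N X \<alpha> a where "N = H20_norm T e" and "X = L2_norm T P"
    and "\<alpha> = 1 / (2 * T * exp 1)" and "a = 1 + \<mu> * T\<^sup>2"
  assume "\<not> ?thesis"
  then have X: "stability_const T \<mu> * N < X" by (simp add: N_def X_def)
  have \<alpha>: "\<alpha> > 0" using T by (simp add: \<alpha>_def)
  have a: "a \<ge> 1" using \<mu> by (simp add: a_def)
  have N0: "0 \<le> N" using H2_norm_bounds(1)[OF T e] L2_norm_nonneg[of T r] unfolding N_def by linarith
  have C: "stability_const T \<mu> = (a + T) / \<alpha> + 1"
    by (simp add: stability_const_def \<alpha>_def a_def)
  have "(a + T) * N + \<alpha> * N = \<alpha> * (stability_const T \<mu> * N)"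
    unfolding C using \<alpha> by (simp add: field_simps)
  also have "\<dots> < \<alpha> * X" using X \<alpha> by simp
  finally have 1: "(a + T) * N + \<alpha> * N < \<alpha> * X" .
  have "N \<le> stability_const T \<mu> * N"
    unfolding C distrib_right using N0 \<alpha> a T by simp
  then have NX: "N < X" using X by simp
  then have X0: "X > 0" using N0 by simp
  have "(a + T) * N * X < \<alpha> * X * X"
  proof (rule mult_strict_right_mono[OF _ X0])
    have "0 \<le> \<alpha> * N" using \<alpha> N0 by simp
    then show "(a + T) * N < \<alpha> * X" using 1 by linarith
  qed
  moreover have "a * N * X + T * N * N \<le> (a + T) * N * X"
  proof -
    have "T * N * N \<le> T * N * X" using NX T N0 by (intro mult_left_mono) auto
    then show ?thesis by (simp add: distrib_right)
  qed
  \<comment> \<open>Young's inequality, balanced so that (P 0)^2 / 2 cancels the same term in the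
    coercivity estimate.\<close>
  moreover have "sqrt T * N * \<bar>P 0\<bar> \<le> T * N * N / 2 + (P 0)\<^sup>2 / 2"
    using sum_squares_bound[of "sqrt T * N" "\<bar>P 0\<bar>"] T by (simp add: power2_eq_square mult_ac)
  moreover have "\<alpha> * X\<^sup>2 + (P 0)\<^sup>2 / 2 \<le> a * N * X + sqrt T * N * \<bar>P 0\<bar>"
    using a_form_coercive[OF T \<mu> w] a_form_bounded[OF T \<mu> e w(1)] unfolding eq N_def X_def a_def \<alpha>_def
    by linarith
  moreover have "0 \<le> T * N * N" using T N0 by simp
  ultimately show False by (simp add: power2_eq_square mult.assoc)
qed

section \<open>Quasi-optimality and approximation\<close>

lemma a_form_lincomb:
  assumes T: "T > 0" and u: "H2_rep T u U P q" and v: "H2_rep T v V R s"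
    and z: "H2_rep T z (\<lambda>t. a * U t + b * V t) (\<lambda>t. a * P t + b * R t) (\<lambda>t. a * q t + b * s t)"
    and w: "H2_rep T w W Q r"
  shows "a_form T \<mu> z w = a * a_form T \<mu> u w + b * a_form T \<mu> v w"
  unfolding a_form_rep[OF T z w] a_form_rep[OF T u w] a_form_rep[OF T v w]
    L2_inner_lincomb_left[OF H2_rep_L2(3)[OF u] H2_rep_L2(3)[OF v] H2_rep_L2(2)[OF w]]
    L2_inner_lincomb_left[OF H2_rep_L2(1)[OF u] H2_rep_L2(1)[OF v] H2_rep_L2(2)[OF w]]
  by (simp add: algebra_simps)

lemma H20_norm_lincomb:
  assumes T: "T > 0" and u: "H2_rep T u U P q" and v: "H2_rep T v V R s"
    and z: "H2_rep T z (\<lambda>t. a * U t + b * V t) (\<lambda>t. a * P t + b * R t) (\<lambda>t. a * q t + b * s t)"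
  shows "H20_norm T z \<le> \<bar>a\<bar> * H20_norm T u + \<bar>b\<bar> * H20_norm T v"
proof -
  have "1 / T * L2_norm T (\<lambda>t. a * P t + b * R t) \<le> 1 / T * (\<bar>a\<bar> * L2_norm T P + \<bar>b\<bar> * L2_norm T R)"
    using T by (intro mult_left_mono L2_norm_lincomb H2_rep_L2[OF u] H2_rep_L2[OF v]) auto
  with L2_norm_lincomb[OF H2_rep_L2(3)[OF u] H2_rep_L2(3)[OF v], of a b] show ?thesis
    unfolding H20_norm_rep[OF T u] H20_norm_rep[OF T v] H20_norm_rep[OF T z]
    by (simp add: algebra_simps)
qed

lemma fin_dim_subspace_H20: "fin_dim_subspace T V \<Longrightarrow> v \<in> V \<Longrightarrow> v \<in> H20 T"
  by (auto simp: fin_dim_subspace_def)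

lemma fin_dim_subspace_lincomb:
  assumes "fin_dim_subspace T V" "v \<in> V" "w \<in> V"
  obtains z where "z \<in> V" "ae_eq T z (\<lambda>t. a * v t + b * w t)"
  using assms unfolding fin_dim_subspace_def by meson

text \<open>Split u - uh into u - z and the discrete part x = uh - z. Orthogonality and
  \<open>stability_estimate\<close> bound only the first derivative of x; the inverse inequality
  raises this to the full norm at the cost of the factor \<open>K\<close>.\<close>

lemma quasi_optimality:
  assumes T: "T > 0" and \<mu>: "\<mu> \<ge> 0" and V: "fin_dim_subspace T V"
    and u: "is_solution T \<mu> f u" and uh: "is_discrete_solution T \<mu> f V uh" and z: "z \<in> V"
    and inv: "\<And>w. w \<in> V \<Longrightarrow> H20_norm T w \<le> K * L2_norm T (weak_deriv T 1 w)" and K: "K \<ge> 0"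
  shows "H20_norm T (\<lambda>t. u t - uh t)
    \<le> (1 + K * stability_const T \<mu>) * H20_norm T (\<lambda>t. u t - z t)"
proof -
  have uhV: "uh \<in> V" using uh by (simp add: is_discrete_solution_def)
  have "u \<in> H20 T" using u by (simp add: is_solution_def)
  then obtain U P q where ru: "H2_rep T u U P q" and U0: "U 0 = 0" by (rule H20_rep[OF T])
  obtain Y R s where rh: "H2_rep T uh Y R s" and Y0: "Y 0 = 0"
    by (rule H20_rep[OF T fin_dim_subspace_H20[OF V uhV]])
  obtain Z Q r where rz: "H2_rep T z Z Q r" and Z0: "Z 0 = 0"
    by (rule H20_rep[OF T fin_dim_subspace_H20[OF V z]])
  \<comment> \<open>\<open>V\<close> is closed under linear combinations only up to null sets, so
    the difference is represented by some element of \<open>V\<close>.\<close>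
  obtain x where x: "x \<in> V" and xae: "ae_eq T x (\<lambda>t. 1 * uh t + (-1) * z t)"
    by (rule fin_dim_subspace_lincomb[OF V uhV z])
  have m: "u \<in> borel_measurable (M_int T)" "uh \<in> borel_measurable (M_int T)" "z \<in> borel_measurable (M_int T)"
    using ru rh rz by (auto simp: H2_rep_def)
  have "x \<in> borel_measurable (M_int T)"
    by (rule H20_rep[OF T fin_dim_subspace_H20[OF V x]]) (auto simp: H2_rep_def)
  note rx = H2_rep_lincomb[OF rh rz this xae]
  let ?e = "\<lambda>t. u t - z t" and ?d = "\<lambda>t. u t - uh t"
  have re: "H2_rep T ?e (\<lambda>t. 1 * U t + (-1) * Z t) (\<lambda>t. 1 * P t + (-1) * Q t) (\<lambda>t. 1 * q t + (-1) * r t)"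
    by (rule H2_rep_lincomb[OF ru rz]) (use m in \<open>auto simp: ae_eq_def\<close>)
  note rL = L_op_rep[OF T rx]
  \<comment> \<open>The test function need not belong to \<open>V\<close>; membership in
    \<open>H20 T\<close> makes it admissible in the continuous problem, while the discrete problem
    is tested with it by definition.\<close>
  have "L_op T x \<in> H20 T"
    by (rule H2_rep_H20[OF T rL]) (use T is_primitive_integrable rL in \<open>auto simp: H2_rep_def\<close>)
  then have "a_form T \<mu> u (L_op T x) = a_form T \<mu> uh (L_op T x)"
    using u uh x by (simp add: is_solution_def is_discrete_solution_def)
  then have eq: "a_form T \<mu> x (L_op T x) = a_form T \<mu> ?e (L_op T x)"
    unfolding a_form_lincomb[OF T rh rz rx rL] a_form_lincomb[OF T ru rz re rL] by simp
  have "L2_norm T (weak_deriv T 1 x) \<le> stability_const T \<mu> * H20_norm T ?e"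
    unfolding L2_norm_weak_deriv_rep(1)[OF T rx]
    by (rule stability_estimate[OF T \<mu> re _ rx _ eq]) (use U0 Y0 Z0 in auto)
  then have "K * L2_norm T (weak_deriv T 1 x) \<le> K * (stability_const T \<mu> * H20_norm T ?e)"
    by (rule mult_left_mono[OF _ K])
  then have "H20_norm T x \<le> K * stability_const T \<mu> * H20_norm T ?e"
    using inv[OF x] by (simp add: mult.assoc)
  moreover have "H20_norm T ?d \<le> \<bar>1\<bar> * H20_norm T ?e + \<bar>-1\<bar> * H20_norm T x"
  proof (rule H20_norm_lincomb[OF T re rx])
    show "H2_rep T ?d (\<lambda>t. 1 * (1 * U t + (-1) * Z t) + (-1) * (1 * Y t + (-1) * Z t))
      (\<lambda>t. 1 * (1 * P t + (-1) * Q t) + (-1) * (1 * R t + (-1) * Q t))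
      (\<lambda>t. 1 * (1 * q t + (-1) * r t) + (-1) * (1 * s t + (-1) * r t))"
    proof (rule H2_rep_lincomb[OF re rx])
      show "?d \<in> borel_measurable (M_int T)" using m by simp
      show "ae_eq T ?d (\<lambda>t. 1 * (u t - z t) + (-1) * x t)"
        using xae unfolding ae_eq_def by eventually_elim simp
    qed
  qed
  ultimately show ?thesis by (simp add: distrib_right)
qed

section \<open>Approximation by the discrete spaces\<close>

lemma identity_rep:
  assumes "T > 0"
  shows "H2_rep T (\<lambda>t. t) (\<lambda>t. t) (\<lambda>_. 1) (\<lambda>_. 0)"
proof -
  have "is_primitive T (\<lambda>t. t) (\<lambda>_. 1)" "is_primitive T (\<lambda>_. 1) (\<lambda>_. 0)"
    by (auto intro!: is_primitive_C1 derivative_eq_intros)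
  moreover have "(\<lambda>_. 0) \<in> L2 T" by (rule continuous_on_L2) simp
  ultimately show ?thesis by (simp add: H2_rep_def ae_eq_def)
qed

text \<open>The second weak derivative of the identity vanishes, so the approximation property
  reproduces the identity exactly.\<close>

lemma identity_in_space:
  assumes T: "T > 0" and ap: "approximation_property T p C_a H S" and h: "h \<in> H" and p: "1 \<le> p"
    and V: "fin_dim_subspace T (S h)"
  obtains z where "z \<in> S h" "ae_eq T z (\<lambda>t. t)"
proof -
  note r = identity_rep[OF T]
  have id: "(\<lambda>t. t) \<in> H20 T" by (rule H2_rep_H20[OF T r]) simp
  then have id2: "(\<lambda>t. t) \<in> H20 T \<inter> Hsp T (1 + 1)" by (simp add: H20_def numeral_2_eq_2 del: sobolev.simps)
  have "L2_norm T (weak_deriv T (1 + 1) (\<lambda>t. t)) = 0"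
    using L2_norm_weak_deriv_rep(2)[OF T r] by (simp add: L2_norm_def L2_inner_def one_add_one[symmetric] del: one_add_one)
  then obtain z where z: "z \<in> S h"
    and "\<forall>l\<in>{0, 1, 2}. l \<le> 1 \<longrightarrow> L2_norm T (\<lambda>t. weak_deriv T l (\<lambda>t. t) t - weak_deriv T l z t) \<le> 0"
    using ap[unfolded approximation_property_def, rule_format, OF h p id2] by auto
  \<comment> \<open>The approximation property is used with s = 1 and l = 0, where its right-hand
    side is zero.\<close>
  then have "L2_norm T (\<lambda>t. t - z t) \<le> 0" by (auto dest: bspec[of _ _ 0])
  then have n: "L2_norm T (\<lambda>t. t - z t) = 0" by (simp add: antisym)
  have "z \<in> H20 T" by (rule fin_dim_subspace_H20[OF V z])
  then obtain Z Q s where rz: "H2_rep T z Z Q s" by (rule H20_rep[OF T])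
  have zL: "z \<in> L2 T"
    using rz by (auto simp: H2_rep_def intro: L2_ae_eq_cont is_primitive_continuous)
  have "(\<lambda>t. 1 * t + (-1) * z t) \<in> L2 T"
    by (rule L2_lincomb[OF _ zL]) (intro continuous_on_L2 continuous_intros)
  then have "integrable (M_int T) (\<lambda>t. (t - z t)\<^sup>2)" by (simp add: L2_def)
  moreover have "(LINT t|M_int T. (t - z t)\<^sup>2) = 0" using n L2_norm_power2[of T "\<lambda>t. t - z t"] by simp
  ultimately have "AE t in M_int T. (t - z t)\<^sup>2 = 0"
    by (subst (asm) integral_nonneg_eq_0_iff_AE) auto
  then have "ae_eq T z (\<lambda>t. t)" unfolding ae_eq_def by eventually_elim simp
  with z show thesis by (rule that)
qed

text \<open>For the identity the first derivative is 1 and the second is 0, so the inverse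
  inequality reads 1/T \<le> C_I/h.\<close>

lemma mesh_size_bound:
  assumes T: "T > 0" and h: "h > 0" and z: "z \<in> borel_measurable (M_int T)" "ae_eq T z (\<lambda>t. t)"
    and inv: "H20_norm T z \<le> C_I / h * L2_norm T (weak_deriv T 1 z)"
  shows "h \<le> C_I * T"
proof -
  have r: "H2_rep T z (\<lambda>t. t) (\<lambda>_. 1) (\<lambda>_. 0)"
    using identity_rep[OF T] z by (simp add: H2_rep_def)
  have "1 / T * sqrt T \<le> C_I / h * sqrt T"
    using inv unfolding H20_norm_rep[OF T r] L2_norm_weak_deriv_rep[OF T r] L2_norm_const[OF T] by simp
  then show ?thesis using T h by (simp add: field_simps)
qed

text \<open>Subtracting the line with slope \<open>P 0\<close> keeps the second derivative and makes
  the first one start at 0. The norm of the first derivative is then at most T times that of the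
  second, so both parts of the \<open>H20_norm\<close> are bounded by the norm of the second
  derivative.\<close>

lemma linear_approximation:
  assumes T: "T > 0" and V: "fin_dim_subspace T V" and z: "z \<in> V" "ae_eq T z (\<lambda>t. t)"
    and u: "u \<in> H20 T"
  obtains y where "y \<in> V" "H20_norm T (\<lambda>t. u t - y t) \<le> 2 * L2_norm T (weak_deriv T 2 u)"
proof -
  obtain U P q where ru: "H2_rep T u U P q" and U0: "U 0 = 0" by (rule H20_rep[OF T u])
  obtain y where y: "y \<in> V" and yz: "ae_eq T y (\<lambda>t. P 0 * z t + 0 * z t)"
    by (rule fin_dim_subspace_lincomb[OF V z(1) z(1)])
  have yae: "ae_eq T y (\<lambda>t. P 0 * t)" using yz z(2) unfolding ae_eq_def by eventually_elim simp
  have m: "u \<in> borel_measurable (M_int T)" "y \<in> borel_measurable (M_int T)"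
    using ru H20_rep[OF T fin_dim_subspace_H20[OF V y]] by (auto simp: H2_rep_def)
  have r: "H2_rep T (\<lambda>t. u t - y t) (\<lambda>t. 1 * U t + (- P 0) * t) (\<lambda>t. 1 * P t + (- P 0) * 1) (\<lambda>t. 1 * q t + (- P 0) * 0)"
  proof (rule H2_rep_lincomb[OF ru identity_rep[OF T]])
    show "(\<lambda>t. u t - y t) \<in> borel_measurable (M_int T)" using m by simp
    show "ae_eq T (\<lambda>t. u t - y t) (\<lambda>t. 1 * u t + (- P 0) * t)"
      using yae unfolding ae_eq_def by eventually_elim simp
  qed
  then have p: "is_primitive T (\<lambda>t. 1 * P t + (- P 0) * 1) (\<lambda>t. 1 * q t + (- P 0) * 0)"
    and q: "(\<lambda>t. 1 * q t + (- P 0) * 0) \<in> L2 T" by (auto simp: H2_rep_def)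
  have "L2_norm T (\<lambda>t. 1 * P t + (- P 0) * 1) \<le> T * L2_norm T q"
    using L2_norm_primitive_zero[OF T p _ q] by simp
  then have "H20_norm T (\<lambda>t. u t - y t) \<le> 2 * L2_norm T (weak_deriv T 2 u)"
    unfolding H20_norm_rep[OF T r] L2_norm_weak_deriv_rep[OF T ru] using T by (simp add: field_simps)
  with y show thesis by (rule that)
qed

text \<open>The second derivative is approximated to order s - 1 and the first to order s. In the
  latter one factor h is traded for C T, whose T cancels the weight 1/T in the norm.\<close>

lemma high_order_approximation:
  assumes T: "T > 0" and ap: "approximation_property T p C_a H S" and h: "h \<in> H" "0 < h" "h \<le> C * T"
    and C_a: "C_a > 0" and s: "2 \<le> s" "s \<le> p" and V: "fin_dim_subspace T (S h)"
    and u: "u \<in> H20 T \<inter> Hsp T (s + 1)"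
  obtains y where "y \<in> S h"
    "H20_norm T (\<lambda>t. u t - y t) \<le> C_a * (1 + C) * h ^ (s - 1) * L2_norm T (weak_deriv T (s + 1) u)"
proof -
  let ?D = "L2_norm T (weak_deriv T (s + 1) u)"
  obtain y where y: "y \<in> S h" and b: "\<forall>l\<in>{0, 1, 2}. l \<le> s \<longrightarrow>
      L2_norm T (\<lambda>t. weak_deriv T l u t - weak_deriv T l y t) \<le> C_a * h ^ (s + 1 - l) * ?D"
    using ap[unfolded approximation_property_def, rule_format, OF h(1) s(2) u] by blast
  have "u \<in> H20 T" using u by simp
  then obtain U P q where ru: "H2_rep T u U P q" by (rule H20_rep[OF T])
  obtain Y R r where ry: "H2_rep T y Y R r"
    by (rule H20_rep[OF T fin_dim_subspace_H20[OF V y]])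
  have rd: "H2_rep T (\<lambda>t. u t - y t) (\<lambda>t. 1 * U t + (-1) * Y t) (\<lambda>t. 1 * P t + (-1) * R t) (\<lambda>t. 1 * q t + (-1) * r t)"
    by (rule H2_rep_lincomb[OF ru ry]) (use ru ry in \<open>auto simp: ae_eq_def H2_rep_def\<close>)
  note du = H2_rep_weak_deriv[OF T ru] and dy = H2_rep_weak_deriv[OF T ry]
  note L = H2_rep_L2[OF rd, THEN L2_measurable]
  have 1: "L2_norm T (\<lambda>t. weak_deriv T 1 u t - weak_deriv T 1 y t) = L2_norm T (\<lambda>t. 1 * P t + (-1) * R t)"
  proof (rule L2_norm_cong[OF _ L(2)])
    show "ae_eq T (\<lambda>t. weak_deriv T 1 u t - weak_deriv T 1 y t) (\<lambda>t. 1 * P t + (-1) * R t)"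
      using du(4) dy(4) unfolding ae_eq_def by eventually_elim simp
  qed (use du(3) dy(3) in simp)
  have 2: "L2_norm T (\<lambda>t. weak_deriv T 2 u t - weak_deriv T 2 y t) = L2_norm T (\<lambda>t. 1 * q t + (-1) * r t)"
  proof (rule L2_norm_cong[OF _ L(3)])
    show "ae_eq T (\<lambda>t. weak_deriv T 2 u t - weak_deriv T 2 y t) (\<lambda>t. 1 * q t + (-1) * r t)"
      using du(6) dy(6) unfolding ae_eq_def by eventually_elim simp
  qed (use du(5) dy(5) in simp)
  have b2: "L2_norm T (\<lambda>t. 1 * q t + (-1) * r t) \<le> C_a * h ^ (s - 1) * ?D"
    using b[rule_format, of 2] s unfolding 2 by (simp add: Suc_diff_le)
  have "L2_norm T (\<lambda>t. 1 * P t + (-1) * R t) \<le> C_a * h ^ s * ?D"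
    using b[rule_format, of 1] s unfolding 1 by simp
  also have "h ^ s = h * h ^ (s - 1)" using s by (simp add: power_eq_if)
  also have "C_a * (h * h ^ (s - 1)) * ?D \<le> C_a * ((C * T) * h ^ (s - 1)) * ?D"
    using h C_a by (intro mult_right_mono mult_left_mono) auto
  finally have "1 / T * L2_norm T (\<lambda>t. 1 * P t + (-1) * R t) \<le> 1 / T * (C_a * ((C * T) * h ^ (s - 1)) * ?D)"
    using T by (intro mult_left_mono) auto
  also have "\<dots> = C_a * C * h ^ (s - 1) * ?D" using T by simp
  finally have "H20_norm T (\<lambda>t. u t - y t) \<le> C_a * (1 + C) * h ^ (s - 1) * ?D"
    unfolding H20_norm_rep[OF T rd] using b2 by (simp add: algebra_simps)
  with y show thesis by (rule that)
qed

text \<open>The constant is chosen before the mesh set, the spaces, the data and s, which expresses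
  its independence of h. The exponent is an integer power because it equals -1 for s = 1.\<close>

theorem corollary3p5:
  fixes T \<mu> C_I C_a :: real and p :: nat
  assumes "T > 0" and "\<mu> > 0" and "C_I > 0" and "C_a > 0"
  shows "\<exists>C_\<mu>>0. \<forall>(H :: real set) (S :: real \<Rightarrow> (real \<Rightarrow> real) set).
           H \<subseteq> {0<..} \<longrightarrow> (\<forall>h\<in>H. fin_dim_subspace T (S h)) \<longrightarrow> assumption_A T p C_I C_a H S \<longrightarrow>
           (\<forall>h\<in>H. \<forall>f\<in>L2 T. \<forall>u uh.
              is_solution T \<mu> f u \<longrightarrow> is_discrete_solution T \<mu> f (S h) uh \<longrightarrow>
              (\<forall>s. 1 \<le> s \<and> s \<le> p \<and> u \<in> H20 T \<inter> Hsp T (s + 1) \<longrightarrow>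
                 H20_norm T (\<lambda>t. u t - uh t)
                   \<le> C_\<mu> * h powi (int s - 2) * L2_norm T (weak_deriv T (s + 1) u)))"
proof -
  let ?c = "stability_const T \<mu>"
  \<comment> \<open>A common approximation constant: 2 serves the linear approximation for s = 1,
    the other entry the case s \<ge> 2.\<close>
  define B where "B = max 2 (C_a * (1 + C_I))"
  define C_\<mu> where "C_\<mu> = C_I * (T + ?c) * B"
  have c: "?c > 0" using assms by (simp add: stability_const_def add_pos_pos)
  have B: "B \<ge> 2" "B \<ge> C_a * (1 + C_I)" by (auto simp: B_def)
  have "C_\<mu> > 0" using assms c B by (simp add: C_\<mu>_def)
  moreover have "H20_norm T (\<lambda>t. u t - uh t) \<le> C_\<mu> * h powi (int s - 2) * L2_norm T (weak_deriv T (s + 1) u)"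
    if "H \<subseteq> {0<..}" "\<forall>h\<in>H. fin_dim_subspace T (S h)" and A: "assumption_A T p C_I C_a H S"
      and h: "h \<in> H" and u: "is_solution T \<mu> f u" and uh: "is_discrete_solution T \<mu> f (S h) uh"
      and s: "1 \<le> s" "s \<le> p" and us: "u \<in> H20 T \<inter> Hsp T (s + 1)"
    for H S h f u uh s
  proof -
    let ?D = "L2_norm T (weak_deriv T (s + 1) u)"
    have h0: "h > 0" and V: "fin_dim_subspace T (S h)" using that(1,2) h by auto
    have ap: "approximation_property T p C_a H S"
      and inv: "\<And>w. w \<in> S h \<Longrightarrow> H20_norm T w \<le> C_I / h * L2_norm T (weak_deriv T 1 w)"
      using A h by (auto simp: assumption_A_def inverse_inequalities_def)
    have "1 \<le> p" using s by simp
    then obtain z where z: "z \<in> S h" "ae_eq T z (\<lambda>t. t)"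
      by (rule identity_in_space[OF assms(1) ap h _ V])
    have "z \<in> borel_measurable (M_int T)"
      by (rule H20_rep[OF assms(1) fin_dim_subspace_H20[OF V z(1)]]) (auto simp: H2_rep_def)
    then have hT: "h \<le> C_I * T" by (rule mesh_size_bound[OF assms(1) h0 _ z(2) inv[OF z(1)]])
    obtain y where y: "y \<in> S h" and yb: "H20_norm T (\<lambda>t. u t - y t) \<le> B * h ^ (s - 1) * ?D"
    proof (cases "s = 1")
      case True
      obtain y where y: "y \<in> S h" "H20_norm T (\<lambda>t. u t - y t) \<le> 2 * L2_norm T (weak_deriv T 2 u)"
        using linear_approximation[OF assms(1) V z] us by blast
      have "2 * ?D \<le> B * ?D" by (rule mult_right_mono[OF B(1)]) simp
      then show thesis using that[OF y(1)] y(2) True by (simp add: numeral_2_eq_2)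
    next
      case False
      then have "2 \<le> s" using s by simp
      then obtain y where y: "y \<in> S h"
        "H20_norm T (\<lambda>t. u t - y t) \<le> C_a * (1 + C_I) * h ^ (s - 1) * ?D"
        using high_order_approximation[OF assms(1) ap h h0 hT assms(4) _ s(2) V us] by blast
      have "C_a * (1 + C_I) * h ^ (s - 1) * ?D \<le> B * h ^ (s - 1) * ?D"
        using h0 by (intro mult_right_mono B) auto
      then show thesis using that[OF y(1)] y(2) by linarith
    qed
    have "H20_norm T (\<lambda>t. u t - uh t) \<le> (1 + C_I / h * ?c) * H20_norm T (\<lambda>t. u t - y t)"
      by (rule quasi_optimality[OF assms(1) less_imp_le[OF assms(2)] V u uh y inv])
        (use assms h0 in auto)
    also have "\<dots> \<le> (1 + C_I / h * ?c) * (B * h ^ (s - 1) * ?D)"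
      using c assms h0 by (intro mult_left_mono[OF yb]) auto
    \<comment> \<open>The mesh bound h \<le> C_I T absorbs the summand 1 into a multiple of 1/h;
      this is the source of T in \<open>C_\<mu>\<close>.\<close>
    also have "\<dots> \<le> (C_I * (T + ?c) / h) * (B * h ^ (s - 1) * ?D)"
      using hT h0 B by (intro mult_right_mono) (auto simp: field_simps)
    also have "\<dots> = C_\<mu> * (h ^ (s - 1) / h) * ?D" by (simp add: C_\<mu>_def)
    also have "h ^ (s - 1) / h = h powi (int s - 2)"
    proof -
      \<comment> \<open>The natural-number exponent s - 1 is exact because s \<ge> 1; only the
        remaining division by h needs an integer exponent.\<close>
      have "h powi (int s - 2) = h powi (int (s - 1) - 1)" using s by (simp add: of_nat_diff)
      also have "\<dots> = h ^ (s - 1) / h" using h0 by (simp add: power_int_diff)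
      finally show ?thesis ..
    qed
    finally show ?thesis .
  qed
  ultimately show ?thesis by blast
qed

end
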